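(* Given a decision tree $T$ over a finite feature set $X$ and an entity $e$ over $X$, it is possible to compute all the necessary features for $T(e)$ in time $O(|X|+|T|)$.
   Context: Features and entities. $X$ is a finite set of features, partitioned as $X=X_C\cup X_N$ into categorical and numerical features. Each $x\in X_C$ has a finite domain $\mathcal{D}_x$; each $x\in X_N$ has domain $\mathcal{D}_x=[m_x,M_x]$ with $m_x\in\mathbb{R}\cup\{-\infty\}$, $M_x\in\mathbb{R}\cup\{\infty\}$. An entity over $X$ is a function $e$ assigning to each $x\in X$ a value $e(x)\in\mathcal{D}_x$. A $k$-class model over $X$ is a map $M$ from the set of entities to $\{0,\dots,k-1\}$. Sufficient reasons. A set $S\subseteq X$ is a reason for $M(e)$ if $M(e')=M(e)$ for every entity $e'$ with $e'(x)=e(x)$ for all $x\in S$. A sufficient reason for $M(e)$ is a reason that is minimal under inclusion. A feature $x$ is necessary for $M(e)$ if $x\in S$ for every sufficient reason $S$ for $M(e)$. Decision trees. A $k$-class decision tree over $X$ is a binary tree $T$ in which every internal node has an ordered pair of children (left, right) and is labeled either by a pair $(x,D)$ with $x\in X_C$, $D\subseteq\mathcal{D}_x$, or by a pair $(x,b)$ with $x\in X_N$, $b\in\mathcal{D}_x$; leaves are labeled with classes in $\{0,\dots,k-1\}$. The literal of a node is $x\in D$, respectively $x\le b$. The prediction $T(e)$ is the label of the leaf reached from the root by moving to the left child if the literal of the current node is satisfied by $e$ (i.e. $e(x)\in D$, respectively $e(x)\le b$), and to the right child otherwise. The size $|T|$ is the number of nodes of $T$. It is assumed without loss of generality that no label is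 of the form $(x,\emptyset)$, $(x,\mathcal{D}_x)$ (categorical) or $(x,M_x)$ (numerical). *)

theory Defs
  imports "HOL-Library.FuncSet" "HOL-Library.Extended_Real"
begin

section \<open>Features, entities and sufficient reasons\<close>

datatype 'c fdomain = Categorical "'c set" | Numerical ereal ereal

datatype 'c fvalue = CatVal 'c | NumVal real

text \<open>The domain of a numerical feature consists of real numbers: an infinite bound means that
  the interval is unbounded on that side, it is not itself a value.\<close>

fun domain_values :: "'c fdomain \<Rightarrow> 'c fvalue set" where
  "domain_values (Categorical D) = CatVal ` D"
| "domain_values (Numerical m M) = NumVal ` {v. m \<le> ereal v \<and> ereal v \<le> M}"

fun admissible_domain :: "'c fdomain \<Rightarrow> bool" where
  "admissible_domain (Categorical D) \<longleftrightarrow> finite D"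
| "admissible_domain (Numerical m M) \<longleftrightarrow> m \<noteq> \<infinity> \<and> M \<noteq> - \<infinity>"

text \<open>The partition of the features into categorical and numerical ones is given by the
  constructor of their domains.\<close>

definition feature_space :: "'f set \<Rightarrow> ('f \<Rightarrow> 'c fdomain) \<Rightarrow> bool" where
  "feature_space X dm \<longleftrightarrow> finite X \<and> (\<forall>x\<in>X. admissible_domain (dm x))"

definition entities :: "'f set \<Rightarrow> ('f \<Rightarrow> 'c fdomain) \<Rightarrow> ('f \<Rightarrow> 'c fvalue) set" where
  "entities X dm = (\<Pi>\<^sub>E x\<in>X. domain_values (dm x))"

definition reason ::
    "'f set \<Rightarrow> ('f \<Rightarrow> 'c fdomain) \<Rightarrow> (('f \<Rightarrow> 'c fvalue) \<Rightarrow> nat) \<Rightarrow> ('f \<Rightarrow> 'c fvalue) \<Rightarrow> 'f set \<Rightarrow> bool" where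
  "reason X dm M e S \<longleftrightarrow>
     S \<subseteq> X \<and> (\<forall>e'\<in>entities X dm. (\<forall>x\<in>S. e' x = e x) \<longrightarrow> M e' = M e)"

definition sufficient_reason ::
    "'f set \<Rightarrow> ('f \<Rightarrow> 'c fdomain) \<Rightarrow> (('f \<Rightarrow> 'c fvalue) \<Rightarrow> nat) \<Rightarrow> ('f \<Rightarrow> 'c fvalue) \<Rightarrow> 'f set \<Rightarrow> bool" where
  "sufficient_reason X dm M e S \<longleftrightarrow>
     reason X dm M e S \<and> (\<forall>S'. S' \<subset> S \<longrightarrow> \<not> reason X dm M e S')"

definition necessary_features ::
    "'f set \<Rightarrow> ('f \<Rightarrow> 'c fdomain) \<Rightarrow> (('f \<Rightarrow> 'c fvalue) \<Rightarrow> nat) \<Rightarrow> ('f \<Rightarrow> 'c fvalue) \<Rightarrow> 'f set" where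
  "necessary_features X dm M e = {x \<in> X. \<forall>S. sufficient_reason X dm M e S \<longrightarrow> x \<in> S}"

section \<open>Decision trees\<close>

datatype ('f, 'c) label = CatLabel 'f "'c set" | NumLabel 'f real

datatype ('f, 'c) dtree = Leaf nat | Node "('f, 'c) label" "('f, 'c) dtree" "('f, 'c) dtree"

fun satisfies :: "('f \<Rightarrow> 'c fvalue) \<Rightarrow> ('f, 'c) label \<Rightarrow> bool" where
  "satisfies e (CatLabel x D) \<longleftrightarrow> e x \<in> CatVal ` D"
| "satisfies e (NumLabel x b) \<longleftrightarrow> e x \<in> NumVal ` {..b}"

fun predict :: "('f, 'c) dtree \<Rightarrow> ('f \<Rightarrow> 'c fvalue) \<Rightarrow> nat" where
  "predict (Leaf c) e = c"
| "predict (Node l t u) e = (if satisfies e l then predict t e else predict u e)"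

fun num_nodes :: "('f, 'c) dtree \<Rightarrow> nat" where
  "num_nodes (Leaf c) = 1"
| "num_nodes (Node l t u) = 1 + num_nodes t + num_nodes u"

fun label_over :: "'f set \<Rightarrow> ('f \<Rightarrow> 'c fdomain) \<Rightarrow> ('f, 'c) label \<Rightarrow> bool" where
  "label_over X dm (CatLabel x D) \<longleftrightarrow> x \<in> X \<and> (\<exists>Dx. dm x = Categorical Dx \<and> D \<subseteq> Dx)"
| "label_over X dm (NumLabel x b) \<longleftrightarrow>
     x \<in> X \<and> (\<exists>m M. dm x = Numerical m M \<and> m \<le> ereal b \<and> ereal b \<le> M)"

fun nontrivial_label :: "('f \<Rightarrow> 'c fdomain) \<Rightarrow> ('f, 'c) label \<Rightarrow> bool" where
  "nontrivial_label dm (CatLabel x D) \<longleftrightarrow> D \<noteq> {} \<and> dm x \<noteq> Categorical D"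
| "nontrivial_label dm (NumLabel x b) \<longleftrightarrow> (\<forall>m. dm x \<noteq> Numerical m (ereal b))"

fun decision_tree :: "nat \<Rightarrow> 'f set \<Rightarrow> ('f \<Rightarrow> 'c fdomain) \<Rightarrow> ('f, 'c) dtree \<Rightarrow> bool" where
  "decision_tree k X dm (Leaf c) \<longleftrightarrow> c < k"
| "decision_tree k X dm (Node l t u) \<longleftrightarrow>
     label_over X dm l \<and> nontrivial_label dm l \<and> decision_tree k X dm t \<and> decision_tree k X dm u"

section \<open>A unit-cost random access machine\<close>

text \<open>The size of a tree is its number of nodes, so a threshold or a set of categorical values
  counts as a single datum however large its description. Accordingly a memory cell holds a
  natural number (address, index, class), an extended real, a categorical value, or a set of
  categorical values, and there is a fixed repertoire of unit-cost operations on each sort: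
  addition, truncated subtraction and comparison of naturals, comparison of reals, and membership,
  intersection, difference and emptiness for sets. Constants in a program are natural numbers
  only. Operations on operands of the wrong sort are undefined (the machine gets stuck).\<close>

datatype 'c cell = CNat nat | CNum ereal | CElem 'c | CSet "'c set"

type_synonym reg = nat

text \<open>The first component holds the registers, which a program can only name explicitly; the
  second one is the memory, accessed indirectly through addresses held in registers.\<close>

type_synonym 'c state = "(reg \<Rightarrow> 'c cell) \<times> (nat \<Rightarrow> 'c cell)"

datatype instr =
    IConst reg nat
  | IMove reg reg
  | ILoad reg reg
  | IStore reg reg
  | IAdd reg reg reg
  | ISub reg reg reg
  | IInter reg reg reg
  | IDiff reg reg reg

fun exec_instr :: "instr \<Rightarrow> 'c state \<Rightarrow> 'c state option" where
  "exec_instr (IConst r n) (R, M) = Some (R(r := CNat n), M)"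
| "exec_instr (IMove r p) (R, M) = Some (R(r := R p), M)"
| "exec_instr (ILoad r p) (R, M) =
     (case R p of CNat a \<Rightarrow> Some (R(r := M a), M) | _ \<Rightarrow> None)"
| "exec_instr (IStore p r) (R, M) =
     (case R p of CNat a \<Rightarrow> Some (R, M(a := R r)) | _ \<Rightarrow> None)"
| "exec_instr (IAdd r p q) (R, M) =
     (case (R p, R q) of (CNat a, CNat b) \<Rightarrow> Some (R(r := CNat (a + b)), M) | _ \<Rightarrow> None)"
| "exec_instr (ISub r p q) (R, M) =
     (case (R p, R q) of (CNat a, CNat b) \<Rightarrow> Some (R(r := CNat (a - b)), M) | _ \<Rightarrow> None)"
| "exec_instr (IInter r p q) (R, M) =
     (case (R p, R q) of (CSet A, CSet B) \<Rightarrow> Some (R(r := CSet (A \<inter> B)), M) | _ \<Rightarrow> None)"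
| "exec_instr (IDiff r p q) (R, M) =
     (case (R p, R q) of (CSet A, CSet B) \<Rightarrow> Some (R(r := CSet (A - B)), M) | _ \<Rightarrow> None)"

datatype test =
    TNatLe reg reg
  | TNumLe reg reg
  | TMember reg reg
  | TEmpty reg

fun eval_test :: "test \<Rightarrow> 'c state \<Rightarrow> bool option" where
  "eval_test (TNatLe p q) (R, M) =
     (case (R p, R q) of (CNat a, CNat b) \<Rightarrow> Some (a \<le> b) | _ \<Rightarrow> None)"
| "eval_test (TNumLe p q) (R, M) =
     (case (R p, R q) of (CNum a, CNum b) \<Rightarrow> Some (a \<le> b) | _ \<Rightarrow> None)"
| "eval_test (TMember p q) (R, M) =
     (case (R p, R q) of (CElem v, CSet A) \<Rightarrow> Some (v \<in> A) | _ \<Rightarrow> None)"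
| "eval_test (TEmpty p) (R, M) =
     (case R p of CSet A \<Rightarrow> Some (A = {}) | _ \<Rightarrow> None)"

datatype program =
    Skip
  | Instr instr
  | Seq program program
  | Cond test program program
  | Loop test program

text \<open>\<open>run P s t s'\<close>: started in state \<open>s\<close>, program \<open>P\<close> halts after \<open>t\<close> steps in state \<open>s'\<close>.\<close>

inductive run :: "program \<Rightarrow> 'c state \<Rightarrow> nat \<Rightarrow> 'c state \<Rightarrow> bool" where
  run_Skip: "run Skip s 1 s"
| run_Instr: "exec_instr i s = Some s' \<Longrightarrow> run (Instr i) s 1 s'"
| run_Seq: "run P s t1 s' \<Longrightarrow> run Q s' t2 s'' \<Longrightarrow> run (Seq P Q) s (t1 + t2) s''"
| run_CondT: "eval_test b s = Some True \<Longrightarrow> run P s t s' \<Longrightarrow> run (Cond b P Q) s (1 + t) s'"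
| run_CondF: "eval_test b s = Some False \<Longrightarrow> run Q s t s' \<Longrightarrow> run (Cond b P Q) s (1 + t) s'"
| run_LoopF: "eval_test b s = Some False \<Longrightarrow> run (Loop b P) s 1 s"
| run_LoopT: "eval_test b s = Some True \<Longrightarrow> run P s t1 s' \<Longrightarrow> run (Loop b P) s' t2 s'' \<Longrightarrow>
    run (Loop b P) s (1 + t1 + t2) s''"

inductive_cases run_SkipE: "run Skip s t s'"
inductive_cases run_InstrE: "run (Instr i) s t s'"
inductive_cases run_SeqE: "run (Seq P Q) s t s'"
inductive_cases run_CondE: "run (Cond b P Q) s t s'"
inductive_cases run_LoopE: "run (Loop b P) s t s'"

lemma run_deterministic:
  "run P s t s' \<Longrightarrow> run P s u s'' \<Longrightarrow> t = u \<and> s' = s''"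
proof (induction arbitrary: u s'' rule: run.induct)
  case (run_Skip s)
  then show ?case by (auto elim: run_SkipE)
next
  case (run_Instr i s s')
  then show ?case by (auto elim: run_InstrE)
next
  case (run_Seq P s t1 s1 Q t2 s2)
  from run_Seq.prems obtain v1 r v2 where "run P s v1 r" "run Q r v2 s''" "u = v1 + v2"
    by (rule run_SeqE)
  with run_Seq.IH show ?case by metis
next
  case (run_CondT b s P t s1 Q)
  from run_CondT.prems run_CondT.hyps(1) obtain v where "run P s v s''" "u = 1 + v"
    by - (erule run_CondE; simp)
  with run_CondT.IH show ?case by metis
next
  case (run_CondF b s Q t s1 P)
  from run_CondF.prems run_CondF.hyps(1) obtain v where "run Q s v s''" "u = 1 + v"
    by - (erule run_CondE; simp)
  with run_CondF.IH show ?case by metis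
next
  case (run_LoopF b s P)
  from run_LoopF.prems run_LoopF.hyps show ?case
    by - (erule run_LoopE; simp)
next
  case (run_LoopT b s P t1 s1 t2 s2)
  from run_LoopT.prems run_LoopT.hyps(1) obtain v1 r v2
    where "run P s v1 r" "run (Loop b P) r v2 s''" "u = 1 + v1 + v2"
    by - (erule run_LoopE; simp)
  with run_LoopT.IH show ?case by metis
qed

section \<open>Input and output format\<close>

text \<open>The features are presented in the order of a duplicate-free list \<open>fs\<close> and are referred to
  by their positions in it.\<close>

definition position :: "'f list \<Rightarrow> 'f \<Rightarrow> nat" where
  "position fs x = (THE i. i < length fs \<and> fs ! i = x)"

fun domain_cells :: "'c fdomain \<Rightarrow> 'c cell list" where
  "domain_cells (Categorical D) = [CNat 0, CSet D, CNat 0]"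
| "domain_cells (Numerical m M) = [CNat 1, CNum m, CNum M]"

fun value_cell :: "'c fvalue \<Rightarrow> 'c cell" where
  "value_cell (CatVal v) = CElem v"
| "value_cell (NumVal v) = CNum (ereal v)"

definition feature_table ::
    "'f list \<Rightarrow> ('f \<Rightarrow> 'c fdomain) \<Rightarrow> ('f \<Rightarrow> 'c fvalue) \<Rightarrow> 'c cell list" where
  "feature_table fs dm e = concat (map (\<lambda>x. domain_cells (dm x) @ [value_cell (e x)]) fs)"

fun label_cells :: "'f list \<Rightarrow> ('f, 'c) label \<Rightarrow> 'c cell list" where
  "label_cells fs (CatLabel x D) = [CNat 1, CNat (position fs x), CSet D]"
| "label_cells fs (NumLabel x b) = [CNat 2, CNat (position fs x), CNum (ereal b)]"

text \<open>\<open>tree_cells fs a T\<close> is the linked representation of \<open>T\<close> placed at address \<open>a\<close>: a leaf is a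
  tag and a class, an internal node is its label followed by the addresses of its two children.\<close>

fun tree_cells :: "'f list \<Rightarrow> nat \<Rightarrow> ('f, 'c) dtree \<Rightarrow> 'c cell list" where
  "tree_cells fs a (Leaf c) = [CNat 0, CNat c]"
| "tree_cells fs a (Node l t u) =
     (let a1 = a + 5; ts = tree_cells fs a1 t; a2 = a1 + length ts
      in label_cells fs l @ [CNat a1, CNat a2] @ ts @ tree_cells fs a2 u)"

definition input_cells ::
    "'f list \<Rightarrow> ('f \<Rightarrow> 'c fdomain) \<Rightarrow> ('f, 'c) dtree \<Rightarrow> ('f \<Rightarrow> 'c fvalue) \<Rightarrow> 'c cell list" where
  "input_cells fs dm T e = feature_table fs dm e @ tree_cells fs (4 * length fs) T"

text \<open>Initially register 0 holds the number of features, register 1 the address of the root, and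
  register 2 the first address beyond the input; the feature table starts at address 0. All other
  registers and all memory cells beyond the input contain the number 0.\<close>

definition initial_state ::
    "'f list \<Rightarrow> ('f \<Rightarrow> 'c fdomain) \<Rightarrow> ('f, 'c) dtree \<Rightarrow> ('f \<Rightarrow> 'c fvalue) \<Rightarrow> 'c state" where
  "initial_state fs dm T e =
     (let I = input_cells fs dm T e
      in ((\<lambda>_. CNat 0)(0 := CNat (length fs), 1 := CNat (4 * length fs), 2 := CNat (length I)),
          (\<lambda>a. if a < length I then I ! a else CNat 0)))"

text \<open>A set of features is output as its characteristic vector, stored from address \<open>a\<close> on.\<close>

definition outputs_set :: "'f list \<Rightarrow> nat \<Rightarrow> 'c state \<Rightarrow> 'f set \<Rightarrow> bool" where
  "outputs_set fs a s A \<longleftrightarrow>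
     (\<forall>i < length fs. snd s (a + i) = CNat (if fs ! i \<in> A then 1 else 0))"

end

theory Submission imports Defs begin

text \<open>A feature \<open>x\<close> is necessary iff \<open>X - {x}\<close> is not a reason, that is, iff some entity that differs
  from \<open>e\<close> in \<open>x\<close> only is classified differently. Such an entity follows the path of \<open>e\<close> up to a
  node labelled by \<open>x\<close>, where it leaves it; from there on it agrees with \<open>e\<close> on every literal
  that is not about \<open>x\<close>. It therefore suffices to walk down the path of \<open>e\<close>, maintaining for each
  feature the set of values consistent with the path, and then to search every branch leaving the
  path with the one feature and the set of values that lead into it. Distinct branches are disjoint
  subtrees, so every node is visited at most once.\<close>

section \<open>Necessity of a feature\<close>

text \<open>The branches are stacked rather than searched when they are met, because the class
  \<open>predict T e\<close>, with which their leaves are compared, is known only at the end of the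
  path. Emptiness of a value set is tested only at the leaves: a branch with no values left costs at
  most its own nodes, which the bound grants anyway, and marks nothing. No work is done per feature
  outside the nodes. The value sets live in the domain cells of the input and overwrite them, and
  the output zone is 0 from the start. The time reached is therefore linear in the number of nodes
  alone, and a fortiori in the sum. One triple of cells per feature suffices because literals about
  one feature cut out a single set of categorical values or a single interval. The delicate point is
  the numerical case: values are real while bounds may be infinite, and an interval is closed below
  at the bound of the domain but open below at a threshold, so the two kinds of interval need
  different tests for emptiness.\<close>

lemma reason_mono: "reason X dm M e S \<Longrightarrow> S \<subseteq> S' \<Longrightarrow> S' \<subseteq> X \<Longrightarrow> reason X dm M e S'"
  unfolding reason_def by blast

lemma reason_imp_sufficient_reason:
  assumes "finite S" "reason X dm M e S"
  shows "\<exists>S'\<subseteq>S. sufficient_reason X dm M e S'"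
  using assms
proof (induction S rule: finite_psubset_induct)
  case (psubset S)
  show ?case
  proof (cases "\<exists>S'\<subset>S. reason X dm M e S'")
    case True
    then obtain S' where "S' \<subset> S" "reason X dm M e S'" by blast
    with psubset.IH[of S'] show ?thesis by blast
  next
    case False
    with psubset.prems have "sufficient_reason X dm M e S"
      unfolding sufficient_reason_def by blast
    then show ?thesis by blast
  qed
qed

text \<open>Entities are extensional functions: outside \<open>X\<close> they all take the same
  default value. Agreement with \<open>e\<close> on \<open>X - {x}\<close> thus forces the form
  \<open>e(x := v)\<close>.\<close>

lemma not_reason_Diff_singleton:
  assumes "e \<in> entities X dm" "x \<in> X"
  shows "\<not> reason X dm M e (X - {x}) \<longleftrightarrow> (\<exists>v \<in> domain_values (dm x). M (e(x := v)) \<noteq> M e)"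
proof
  assume "\<not> reason X dm M e (X - {x})"
  then obtain e' where e': "e' \<in> entities X dm" "\<forall>y\<in>X - {x}. e' y = e y" "M e' \<noteq> M e"
    unfolding reason_def by auto
  have "e' = e(x := e' x)"
  proof
    fix y
    show "e' y = (e(x := e' x)) y"
    proof (cases "y \<in> X")
      case True
      then show ?thesis using e'(2) by simp
    next
      case False
      then have "e' y = undefined" "e y = undefined"
        using e'(1) assms(1) unfolding entities_def by (blast intro: PiE_arb)+
      then show ?thesis using False assms(2) by auto
    qed
  qed
  with e'(3) have "M (e(x := e' x)) \<noteq> M e" by simp
  moreover have "e' x \<in> domain_values (dm x)"
    using e'(1) assms(2) unfolding entities_def by (rule PiE_mem)
  ultimately show "\<exists>v \<in> domain_values (dm x). M (e(x := v)) \<noteq> M e" ..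
next
  assume "\<exists>v \<in> domain_values (dm x). M (e(x := v)) \<noteq> M e"
  then obtain v where v: "v \<in> domain_values (dm x)" "M (e(x := v)) \<noteq> M e" by blast
  have "e(x := v) \<in> entities X dm"
    using assms v(1) PiE_fun_upd[of v "\<lambda>x. domain_values (dm x)" x e X] unfolding entities_def
    by (simp add: insert_absorb)
  moreover have "\<forall>y\<in>X - {x}. (e(x := v)) y = e y" by simp
  ultimately show "\<not> reason X dm M e (X - {x})"
    using v(2) unfolding reason_def by blast
qed

text \<open>Reasons are upward closed within \<open>X\<close>, so a sufficient reason that avoids
  \<open>x\<close> makes \<open>X - {x}\<close> a reason. Conversely, if \<open>X - {x}\<close> is a
  reason, finiteness lets it shrink to a minimal one, which avoids \<open>x\<close>.\<close>

lemma necessary_features_eq: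
  assumes "finite X" "e \<in> entities X dm"
  shows "necessary_features X dm M e = {x \<in> X. \<exists>v \<in> domain_values (dm x). M (e(x := v)) \<noteq> M e}"
proof -
  have "(\<forall>S. sufficient_reason X dm M e S \<longrightarrow> x \<in> S) \<longleftrightarrow> \<not> reason X dm M e (X - {x})"
    if "x \<in> X" for x
  proof
    assume *: "\<forall>S. sufficient_reason X dm M e S \<longrightarrow> x \<in> S"
    show "\<not> reason X dm M e (X - {x})"
    proof
      assume "reason X dm M e (X - {x})"
      from reason_imp_sufficient_reason[OF _ this] assms(1)
      obtain S where "S \<subseteq> X - {x}" "sufficient_reason X dm M e S" by auto
      with * show False by blast
    qed
  next
    assume *: "\<not> reason X dm M e (X - {x})"
    show "\<forall>S. sufficient_reason X dm M e S \<longrightarrow> x \<in> S"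
    proof (intro allI impI, rule ccontr)
      fix S assume S: "sufficient_reason X dm M e S" "x \<notin> S"
      then have r: "reason X dm M e S" unfolding sufficient_reason_def by simp
      then have "S \<subseteq> X - {x}" using S(2) unfolding reason_def by blast
      with * reason_mono[OF r this] show False by blast
    qed
  qed
  then show ?thesis
    using not_reason_Diff_singleton[OF assms(2)] unfolding necessary_features_def
    by (intro Collect_cong conj_cong refl) simp
qed

section \<open>Reasoning about programs\<close>

text \<open>Meant for loop-free blocks only, hence \<open>False\<close> for a loop; the two loops of
  the program are left to \<open>loop_run\<close>. Undefined operations also give
  \<open>False\<close>, so the precondition includes termination without getting stuck.\<close>

primrec wp :: "program \<Rightarrow> ('c state \<Rightarrow> bool) \<Rightarrow> 'c state \<Rightarrow> bool" where
  "wp Skip Q s = Q s"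
| "wp (Instr i) Q s = (case exec_instr i s of None \<Rightarrow> False | Some s' \<Rightarrow> Q s')"
| "wp (Seq P1 P2) Q s = wp P1 (wp P2 Q) s"
| "wp (Cond b P1 P2) Q s =
     (case eval_test b s of None \<Rightarrow> False | Some c \<Rightarrow> if c then wp P1 Q s else wp P2 Q s)"
| "wp (Loop b P) Q s = False"

text \<open>A bound over all branches, independent of the state, so that it can enter the final
  constant. The value 0 for a loop is a dummy: \<open>wp_run\<close> is vacuous there.\<close>

primrec cost :: "program \<Rightarrow> nat" where
  "cost Skip = 1"
| "cost (Instr i) = 1"
| "cost (Seq P1 P2) = cost P1 + cost P2"
| "cost (Cond b P1 P2) = 1 + max (cost P1) (cost P2)"
| "cost (Loop b P) = 0"

lemma wp_run: "wp P Q s \<Longrightarrow> \<exists>t s'. run P s t s' \<and> t \<le> cost P \<and> Q s'"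
proof (induction P arbitrary: Q s)
  case Skip
  then show ?case using run_Skip by fastforce
next
  case (Instr i)
  then show ?case using run_Instr by (fastforce split: option.splits)
next
  case (Seq P1 P2)
  from Seq.prems have "wp P1 (wp P2 Q) s" by simp
  from Seq.IH(1)[OF this] obtain t1 s1 where 1: "run P1 s t1 s1" "t1 \<le> cost P1" "wp P2 Q s1"
    by blast
  from Seq.IH(2)[OF 1(3)] obtain t2 s2 where 2: "run P2 s1 t2 s2" "t2 \<le> cost P2" "Q s2"
    by blast
  have "run (Seq P1 P2) s (t1 + t2) s2" using 1 2 run_Seq by blast
  then show ?case using 1 2 by fastforce
next
  case (Cond b P1 P2)
  from Cond.prems consider "eval_test b s = Some True" "wp P1 Q s"
    | "eval_test b s = Some False" "wp P2 Q s"
    by (auto split: option.splits if_splits)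
  then show ?case
  proof cases
    case 1
    from Cond.IH(1)[OF 1(2)] obtain t s' where "run P1 s t s'" "t \<le> cost P1" "Q s'" by blast
    then show ?thesis using run_CondT[OF 1(1)] by fastforce
  next
    case 2
    from Cond.IH(2)[OF 2(2)] obtain t s' where "run P2 s t s'" "t \<le> cost P2" "Q s'" by blast
    then show ?thesis using run_CondF[OF 2(1)] by fastforce
  qed
next
  case (Loop b P)
  then show ?case by simp
qed

text \<open>The number \<open>m\<close> is variant and time budget at once: each round lowers it and
  pays for one test and one body, and the leading 1 pays for the last test. The bound
  \<open>m' \<le> m\<close> is returned so that what the first loop leaves over can bound the
  second.\<close>

lemma loop_run:
  assumes test: "\<And>m s. I m s \<Longrightarrow> eval_test b s \<noteq> None"
    and body: "\<And>m s. I m s \<Longrightarrow> eval_test b s = Some True \<Longrightarrow> wp P (\<lambda>s'. \<exists>m'<m. I m' s') s"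
    and init: "I m s"
  shows "\<exists>t s' m'. run (Loop b P) s t s' \<and> t \<le> 1 + (1 + cost P) * m \<and> m' \<le> m \<and> I m' s' \<and>
           eval_test b s' = Some False"
  using init
proof (induction m arbitrary: s rule: less_induct)
  case (less m)
  show ?case
  proof (cases "eval_test b s = Some True")
    case False
    with test[OF less.prems] have "eval_test b s = Some False" by auto
    then have "run (Loop b P) s 1 s" by (rule run_LoopF)
    moreover have "1 \<le> 1 + (1 + cost P) * m" by simp
    ultimately show ?thesis using less.prems \<open>eval_test b s = Some False\<close> by blast
  next
    case True
    from wp_run[OF body[OF less.prems True]] obtain t1 s1 m1
      where 1: "run P s t1 s1" "t1 \<le> cost P" "m1 < m" "I m1 s1" by blast
    from less.IH[OF 1(3,4)] obtain t2 s2 m2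
      where 2: "run (Loop b P) s1 t2 s2" "t2 \<le> 1 + (1 + cost P) * m1" "m2 \<le> m1" "I m2 s2"
        "eval_test b s2 = Some False" by blast
    have "run (Loop b P) s (1 + t1 + t2) s2"
      using run_LoopT[OF True 1(1) 2(1)] .
    moreover have "1 + t1 + t2 \<le> 1 + (1 + cost P) * Suc m1"
      using 1(2) 2(2) by simp
    then have "1 + t1 + t2 \<le> 1 + (1 + cost P) * m"
      using 1(3) by (meson Suc_leI add_le_mono le_refl le_trans mult_le_mono2)
    moreover have "m2 \<le> m" using 1(3) 2(3) by simp
    ultimately show ?thesis using 2(4,5) by blast
  qed
qed

primrec straight :: "instr list \<Rightarrow> program" where
  "straight [] = Skip"
| "straight (i # is) = Seq (Instr i) (straight is)"

section \<open>The program\<close>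

text \<open>The registers below \<open>r_tmp\<close> are preserved by \<open>visit\<close> and \<open>refine\<close>.\<close>

abbreviation (input) "r_node \<equiv> 1 :: reg"
abbreviation (input) "r_out \<equiv> 2 :: reg"
abbreviation (input) "r_kind \<equiv> 3 :: reg"
abbreviation (input) "r_one \<equiv> 4 :: reg"
abbreviation (input) "r_sp \<equiv> 5 :: reg"
abbreviation (input) "r_bottom \<equiv> 6 :: reg"
abbreviation (input) "r_class \<equiv> 7 :: reg"
abbreviation (input) "r_item \<equiv> 8 :: reg"
abbreviation (input) "r_item_tag \<equiv> 9 :: reg"
abbreviation (input) "r_item_lo \<equiv> 10 :: reg"
abbreviation (input) "r_item_hi \<equiv> 11 :: reg"
abbreviation (input) "r_diff \<equiv> 12 :: reg"
abbreviation (input) "r_tmp \<equiv> 13 :: reg"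
abbreviation (input) "r_feat \<equiv> 14 :: reg"
abbreviation (input) "r_datum \<equiv> 15 :: reg"
abbreviation (input) "r_stay \<equiv> 16 :: reg"
abbreviation (input) "r_off \<equiv> 17 :: reg"
abbreviation (input) "r_val \<equiv> 18 :: reg"
abbreviation (input) "r_tag \<equiv> 19 :: reg"
abbreviation (input) "r_lo \<equiv> 20 :: reg"
abbreviation (input) "r_hi \<equiv> 21 :: reg"
abbreviation (input) "r_stay_tag \<equiv> 22 :: reg"
abbreviation (input) "r_stay_lo \<equiv> 23 :: reg"
abbreviation (input) "r_stay_hi \<equiv> 24 :: reg"
abbreviation (input) "r_off_tag \<equiv> 25 :: reg"
abbreviation (input) "r_off_lo \<equiv> 26 :: reg"
abbreviation (input) "r_off_hi \<equiv> 27 :: reg"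
abbreviation (input) "r_row \<equiv> 28 :: reg"

text \<open>Rows of the feature table are four cells wide and start at address 0; two doublings
  replace the multiplication by 4.\<close>

definition visit :: program where
  "visit = straight [
     IAdd r_tmp r_node r_one, ILoad r_feat r_tmp,
     IAdd r_tmp r_tmp r_one, ILoad r_datum r_tmp,
     IAdd r_tmp r_tmp r_one, ILoad r_stay r_tmp,
     IAdd r_tmp r_tmp r_one, ILoad r_off r_tmp,
     IAdd r_row r_feat r_feat, IAdd r_row r_row r_row, ILoad r_tag r_row,
     IAdd r_tmp r_row r_one, ILoad r_lo r_tmp,
     IAdd r_tmp r_tmp r_one, ILoad r_hi r_tmp,
     IAdd r_tmp r_tmp r_one, ILoad r_val r_tmp]"

definition swap :: program where
  "swap = straight [
     IMove r_tmp r_stay, IMove r_stay r_off, IMove r_off r_tmp,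
     IMove r_tmp r_stay_tag, IMove r_stay_tag r_off_tag, IMove r_off_tag r_tmp,
     IMove r_tmp r_stay_lo, IMove r_stay_lo r_off_lo, IMove r_off_lo r_tmp,
     IMove r_tmp r_stay_hi, IMove r_stay_hi r_off_hi, IMove r_off_hi r_tmp]"

text \<open>The values of a feature that are still allowed are kept as a triple of cells like the one
  describing its domain, with the additional tag 2 for a half-open interval
  \<open>lo < v \<le> hi\<close>. Under tag 1 the lower bound is that of the domain, hence inclusive, and no
  threshold lies below it. The literal splits the triple into the values that move to the left
  and to the right; these are then exchanged if the entity itself moves to the right.\<close>

definition refine :: program where
  "refine =
     Seq (straight [
       IMove r_stay_tag r_tag, IMove r_stay_lo r_lo, IMove r_stay_hi r_hi,
       IMove r_off_tag r_tag, IMove r_off_lo r_lo, IMove r_off_hi r_hi, IConst r_tmp 2])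
     (Cond (TNatLe r_tmp r_kind)
       (Seq (Cond (TNumLe r_datum r_hi) (Instr (IMove r_stay_hi r_datum)) Skip)
       (Seq (Cond (TNatLe r_tmp r_tag)
               (Cond (TNumLe r_lo r_datum) (Instr (IMove r_off_lo r_datum)) Skip)
               (straight [IMove r_off_lo r_datum, IMove r_off_tag r_tmp]))
            (Cond (TNumLe r_val r_datum) Skip swap)))
       (Seq (straight [IInter r_stay_lo r_lo r_datum, IDiff r_off_lo r_lo r_datum])
            (Cond (TMember r_val r_datum) Skip swap)))"

definition push :: "reg \<Rightarrow> reg \<Rightarrow> reg \<Rightarrow> reg \<Rightarrow> reg \<Rightarrow> program" where
  "push r1 r2 r3 r4 r5 = straight [
     IStore r_sp r1, IAdd r_sp r_sp r_one, IStore r_sp r2, IAdd r_sp r_sp r_one,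
     IStore r_sp r3, IAdd r_sp r_sp r_one, IStore r_sp r4, IAdd r_sp r_sp r_one,
     IStore r_sp r5, IAdd r_sp r_sp r_one]"

text \<open>The operand 0 is the register that holds the number of features, so the stack starts right
  behind the output vector.\<close>

definition prepare :: program where
  "prepare = straight [IConst r_one 1, IAdd r_sp r_out 0, IAdd r_bottom r_sp r_one, ILoad r_kind r_node]"

text \<open>The row of the tested feature is overwritten in place, except for its fourth cell, the
  value of the entity. The table thereby always holds the sets consistent with the path.\<close>

definition advance :: program where
  "advance = straight [
     IStore r_row r_stay_tag,
     IAdd r_row r_row r_one, IStore r_row r_stay_lo,
     IAdd r_row r_row r_one, IStore r_row r_stay_hi,
     IMove r_node r_stay, ILoad r_kind r_node]"

definition walk_body :: program where
  "walk_body = Seq visit (Seq refine (Seq (push r_off r_feat r_off_tag r_off_lo r_off_hi) advance))"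

definition read_class :: program where
  "read_class = straight [IAdd r_tmp r_node r_one, ILoad r_class r_tmp]"

definition pop :: program where
  "pop = straight [IConst r_tmp 5, ISub r_sp r_sp r_tmp, ILoad r_node r_sp,
     IAdd r_tmp r_sp r_one, ILoad r_item r_tmp,
     IAdd r_tmp r_tmp r_one, ILoad r_item_tag r_tmp,
     IAdd r_tmp r_tmp r_one, ILoad r_item_lo r_tmp,
     IAdd r_tmp r_tmp r_one, ILoad r_item_hi r_tmp,
     ILoad r_kind r_node]"

definition mark :: program where
  "mark = straight [IAdd r_tmp r_out r_item, IStore r_tmp r_one]"

text \<open>Subtraction is truncated, so the two differences sum to 0 exactly for equal operands;
  this replaces an equality test.\<close>

definition compare :: "reg \<Rightarrow> reg \<Rightarrow> program" where
  "compare p q = straight [ISub r_diff p q, ISub r_tmp q p, IAdd r_diff r_diff r_tmp]"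

text \<open>Tag 1 is marked without a test because \<open>represents\<close> admits only nonempty
  intervals under that tag.\<close>

definition mark_if_nonempty :: program where
  "mark_if_nonempty =
     Seq (Instr (IConst r_tmp 2))
         (Cond (TNatLe r_one r_item_tag)
           (Cond (TNatLe r_tmp r_item_tag) (Cond (TNumLe r_item_hi r_item_lo) Skip mark) mark)
           (Cond (TEmpty r_item_lo) Skip mark))"

definition check_leaf :: program where
  "check_leaf =
     Seq (straight [IAdd r_tmp r_node r_one, ILoad r_feat r_tmp])
    (Seq (compare r_feat r_class)
         (Cond (TNatLe r_one r_diff) mark_if_nonempty Skip))"

text \<open>If the node tests the feature of the entry, the triple of the entry takes the place of
  the table row and is split between the children. Otherwise \<open>refine\<close> serves only to
  route \<open>e\<close>: the triples that it computes are dropped, and the entry passes unchanged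
  to the child that \<open>e\<close> enters.\<close>

definition expand_node :: program where
  "expand_node =
     Seq visit
    (Seq (compare r_feat r_item)
    (Seq (Cond (TNatLe r_one r_diff) Skip
           (straight [IMove r_tag r_item_tag, IMove r_lo r_item_lo, IMove r_hi r_item_hi]))
    (Seq refine
         (Cond (TNatLe r_one r_diff)
           (push r_stay r_item r_item_tag r_item_lo r_item_hi)
           (Seq (push r_stay r_item r_stay_tag r_stay_lo r_stay_hi)
                (push r_off r_item r_off_tag r_off_lo r_off_hi))))))"

definition search_body :: program where
  "search_body = Seq pop (Cond (TNatLe r_one r_kind) expand_node check_leaf)"

text \<open>Strict comparisons are expressed by an offset of one. A leaf has tag 0, so
  \<open>r_one \<le> r_kind\<close> detects an internal node; \<open>r_bottom\<close> is one above
  the start of the stack, so \<open>r_bottom \<le> r_sp\<close> detects a nonempty stack.\<close>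

definition necessary_program :: program where
  "necessary_program =
     Seq prepare
    (Seq (Loop (TNatLe r_one r_kind) walk_body)
    (Seq read_class
         (Loop (TNatLe r_bottom r_sp) search_body)))"

section \<open>Specifications of the blocks\<close>

fun feature :: "('f, 'c) label \<Rightarrow> 'f" where
  "feature (CatLabel x D) = x"
| "feature (NumLabel x b) = x"

fun holds :: "('f, 'c) label \<Rightarrow> 'c fvalue \<Rightarrow> bool" where
  "holds (CatLabel x D) v \<longleftrightarrow> v \<in> CatVal ` D"
| "holds (NumLabel x b) v \<longleftrightarrow> v \<in> NumVal ` {..b}"

lemma satisfies_iff: "satisfies e l \<longleftrightarrow> holds l (e (feature l))"
  by (cases l) auto

lemma add_numeral_Suc:
  "p + 3 = Suc (Suc (Suc p))" "p + 4 = Suc (Suc (Suc (Suc p)))" "p + 5 = Suc (Suc (Suc (Suc (Suc p))))"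
  by simp_all

lemma wp_push:
  assumes "R r_sp = CNat p" "R r_one = CNat 1" "r_sp \<notin> {r1, r2, r3, r4, r5}"
    and "Q (R(r_sp := CNat (p + 5)), M(p := R r1, p + 1 := R r2, p + 2 := R r3, p + 3 := R r4, p + 4 := R r5))"
  shows "wp (push r1 r2 r3 r4 r5) Q (R, M)"
  using assms by (simp add: push_def add_numeral_Suc)


text \<open>Under tag 1 the lower bound is read off the domain and not off the cell
  \<open>a\<close>, which is unconstrained. The three inequalities of that case guarantee that the
  interval contains a real number.\<close>

fun represents :: "'c fdomain \<Rightarrow> 'c cell \<Rightarrow> 'c cell \<Rightarrow> 'c cell \<Rightarrow> 'c fvalue set \<Rightarrow> bool" where
  "represents (Categorical D) t a h V \<longleftrightarrow> (\<exists>S. t = CNat 0 \<and> a = CSet S \<and> V = CatVal ` S)"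
| "represents (Numerical m M) t a h V \<longleftrightarrow>
     (\<exists>hi. h = CNum hi \<and>
       (t = CNat 1 \<and> m \<le> hi \<and> m \<noteq> \<infinity> \<and> hi \<noteq> - \<infinity> \<and> V = NumVal ` {v. m \<le> ereal v \<and> ereal v \<le> hi} \<or>
        (\<exists>lo. t = CNat 2 \<and> a = CNum lo \<and> V = NumVal ` {v. lo < ereal v \<and> ereal v \<le> hi})))"

text \<open>The value \<open>v\<close> is a witness for \<open>m \<le> M\<close>, which tag 1
  demands; admissibility excludes the wrong infinities.\<close>

lemma represents_domain_cells:
  assumes "admissible_domain d" "v \<in> domain_values d"
  shows "represents d (domain_cells d ! 0) (domain_cells d ! 1) (domain_cells d ! 2) (domain_values d)"
  using assms by (cases d) (auto intro: order_trans)

lemma wp_visit: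
  assumes "R r_node = CNat a" "R r_one = CNat 1" "M (a + 1) = CNat i"
    and Q: "\<And>R'. \<forall>r<13. R' r = R r \<Longrightarrow> R' r_feat = CNat i \<Longrightarrow> R' r_datum = M (a + 2) \<Longrightarrow>
      R' r_stay = M (a + 3) \<Longrightarrow> R' r_off = M (a + 4) \<Longrightarrow> R' r_row = CNat (4 * i) \<Longrightarrow>
      R' r_tag = M (4 * i) \<Longrightarrow> R' r_lo = M (4 * i + 1) \<Longrightarrow> R' r_hi = M (4 * i + 2) \<Longrightarrow>
      R' r_val = M (4 * i + 3) \<Longrightarrow> Q (R', M)"
  shows "wp visit Q (R, M)"
proof -
  have four: "i + i + (i + i) = 4 * i" by simp
  show ?thesis
    unfolding visit_def using assms(1-3)
    by (simp del: add.assoc) (rule Q; simp add: four add_numeral_Suc)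
qed

text \<open>Since \<open>m \<le> ereal b\<close>, values above the threshold satisfy the lower bound
  of the domain automatically. The right part is therefore half-open and no longer mentions
  \<open>m\<close>, and the left part keeps its lower bound.\<close>

lemma refine_tag1:
  fixes b :: real
  assumes "V = NumVal ` {v. m \<le> ereal v \<and> ereal v \<le> hi}" "m \<le> ereal b"
  shows "{w \<in> V. holds (NumLabel x b) w} = NumVal ` {v. m \<le> ereal v \<and> ereal v \<le> min (ereal b) hi}"
    and "{w \<in> V. \<not> holds (NumLabel x b) w} = NumVal ` {v. ereal b < ereal v \<and> ereal v \<le> hi}"
proof -
  have "m \<le> ereal v" if "b < v" for v
    using assms(2) that by (meson ereal_less_eq(3) less_imp_le order_trans)
  then show "{w \<in> V. \<not> holds (NumLabel x b) w} = NumVal ` {v. ereal b < ereal v \<and> ereal v \<le> hi}"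
    unfolding assms(1) by (auto simp: image_iff not_le)
  show "{w \<in> V. holds (NumLabel x b) w} = NumVal ` {v. m \<le> ereal v \<and> ereal v \<le> min (ereal b) hi}"
    unfolding assms(1) by (auto simp: image_iff)
qed

lemma refine_tag2:
  fixes b :: real
  assumes "V = NumVal ` {v. lo < ereal v \<and> ereal v \<le> hi}"
  shows "{w \<in> V. holds (NumLabel x b) w} = NumVal ` {v. lo < ereal v \<and> ereal v \<le> min (ereal b) hi}"
    and "{w \<in> V. \<not> holds (NumLabel x b) w} = NumVal ` {v. max lo (ereal b) < ereal v \<and> ereal v \<le> hi}"
  unfolding assms by (auto simp: image_iff not_le)

text \<open>The set \<open>V\<close> is left free: it is the set of the table row during the walk
  and that of a stack entry during the search. Comparing \<open>holds l w\<close> with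
  \<open>holds l v\<close> describes the sides as entered and left by the entity, which absorbs the
  swap.\<close>

lemma wp_refine:
  assumes rep: "represents (dm (feature l)) (R r_tag) (R r_lo) (R r_hi) V"
    and l: "label_over X dm l"
    and cells: "label_cells fs l = [R r_kind, R r_feat, R r_datum]"
    and v: "R r_val = value_cell v" "v \<in> domain_values (dm (feature l))"
    and Q: "\<And>R'. \<forall>r. r < 13 \<or> r = r_feat \<or> r = r_row \<longrightarrow> R' r = R r \<Longrightarrow>
      R' r_stay = (if holds l v then R r_stay else R r_off) \<Longrightarrow>
      R' r_off = (if holds l v then R r_off else R r_stay) \<Longrightarrow>
      represents (dm (feature l)) (R' r_stay_tag) (R' r_stay_lo) (R' r_stay_hi)
        {w \<in> V. holds l w = holds l v} \<Longrightarrow>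
      represents (dm (feature l)) (R' r_off_tag) (R' r_off_lo) (R' r_off_hi)
        {w \<in> V. holds l w \<noteq> holds l v} \<Longrightarrow> Q (R', M)"
  shows "wp refine Q (R, M)"
proof (cases l)
  case (CatLabel x D)
  with l obtain Dx where d: "dm x = Categorical Dx" by auto
  from d rep CatLabel obtain S where S: "R r_tag = CNat 0" "R r_lo = CSet S" "V = CatVal ` S" by auto
  from d CatLabel have dl: "dm (feature l) = Categorical Dx" by simp
  from v d CatLabel obtain w where w: "v = CatVal w" "R r_val = CElem w" by auto
  have in_out: "{y \<in> V. holds l y} = CatVal ` (S \<inter> D)" "{y \<in> V. \<not> holds l y} = CatVal ` (S - D)"
    using S(3) CatLabel by auto
  have kind: "R r_kind = CNat 1" "R r_datum = CSet D" using cells CatLabel by auto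
  have holds: "holds l v \<longleftrightarrow> w \<in> D" using w CatLabel by auto
  show ?thesis
  proof (cases "w \<in> D")
    case True
    with holds have eq: "{y \<in> V. holds l y = holds l v} = CatVal ` (S \<inter> D)"
      "{y \<in> V. holds l y \<noteq> holds l v} = CatVal ` (S - D)" using in_out by auto
    show ?thesis unfolding refine_def
      by (simp add: kind S w True) (rule Q; simp add: eq holds True dl S(1,2) in_out)
  next
    case False
    with holds have eq: "{y \<in> V. holds l y = holds l v} = CatVal ` (S - D)"
      "{y \<in> V. holds l y \<noteq> holds l v} = CatVal ` (S \<inter> D)" using in_out by auto
    show ?thesis unfolding refine_def swap_def
      by (simp add: kind S w False) (rule Q; simp add: eq holds False dl S(1,2) in_out)
  qed
next
  case (NumLabel x b)
  with l obtain m M' where d: "dm x = Numerical m M'" "m \<le> ereal b" by auto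
  from d NumLabel have dl: "dm (feature l) = Numerical m M'" by simp
  from v d NumLabel obtain w where w: "v = NumVal w" "R r_val = CNum (ereal w)" by auto
  have kind: "R r_kind = CNat 2" "R r_datum = CNum (ereal b)" using cells NumLabel by auto
  have holds: "holds l v \<longleftrightarrow> w \<le> b" using w NumLabel by auto
  have eq: "{y \<in> V. holds l y = holds l v} = (if w \<le> b then {y \<in> V. holds l y} else {y \<in> V. \<not> holds l y})"
    "{y \<in> V. holds l y \<noteq> holds l v} = (if w \<le> b then {y \<in> V. \<not> holds l y} else {y \<in> V. holds l y})"
    using holds by auto
  from rep d NumLabel consider
      (1) hi where "R r_tag = CNat 1" "R r_hi = CNum hi" "m \<le> hi" "m \<noteq> \<infinity>" "hi \<noteq> - \<infinity>"
        "V = NumVal ` {v. m \<le> ereal v \<and> ereal v \<le> hi}"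
    | (2) lo hi where "R r_tag = CNat 2" "R r_lo = CNum lo" "R r_hi = CNum hi"
        "V = NumVal ` {v. lo < ereal v \<and> ereal v \<le> hi}"
    by auto
  then show ?thesis
  proof cases
    case 1
    note sets = refine_tag1[OF 1(6) d(2), where x = x, folded NumLabel]
    show ?thesis
      by (cases "ereal b \<le> hi"; cases "w \<le> b"; simp add: refine_def swap_def kind 1(1-5) w;
          rule Q; simp add: eq sets holds dl d(2) min_def 1(1-5) kind)
  next
    case 2
    note sets = refine_tag2[OF 2(4), where x = x and b = b, folded NumLabel]
    show ?thesis
      by (cases "ereal b \<le> hi"; cases "lo \<le> ereal b"; cases "w \<le> b";
          simp add: refine_def swap_def kind 2(1-3) w;
          rule Q; simp add: eq sets holds dl min_def max_def 2(1-3) kind)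
  qed
qed

text \<open>The assumption \<open>i + 3 \<le> b\<close> keeps the three writes away from the next
  node, so its tag can be read from the old memory.\<close>

lemma wp_advance:
  assumes "R r_row = CNat i" "R r_one = CNat 1" "R r_stay = CNat b" "i + 3 \<le> b"
    and Q: "\<And>R'. \<forall>r. r \<notin> {r_node, r_kind, r_row} \<longrightarrow> R' r = R r \<Longrightarrow> R' r_node = CNat b \<Longrightarrow>
      R' r_kind = M b \<Longrightarrow> Q (R', M(i := R r_stay_tag, i + 1 := R r_stay_lo, i + 2 := R r_stay_hi))"
  shows "wp advance Q (R, M)"
proof -
  have "b \<noteq> i" "b \<noteq> Suc i" "b \<noteq> Suc (Suc i)" using assms(4) by auto
  then show ?thesis unfolding advance_def using assms(1-3)
    using Q[simplified] by simp
qed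

lemma wp_pop:
  assumes "R r_sp = CNat (q + 5)" "R r_one = CNat 1" "M q = CNat a"
    and Q: "\<And>R'. \<forall>r\<in>{r_out, r_one, r_bottom, r_class}. R' r = R r \<Longrightarrow> R' r_sp = CNat q \<Longrightarrow>
      R' r_node = CNat a \<Longrightarrow> R' r_item = M (q + 1) \<Longrightarrow> R' r_item_tag = M (q + 2) \<Longrightarrow>
      R' r_item_lo = M (q + 3) \<Longrightarrow> R' r_item_hi = M (q + 4) \<Longrightarrow> R' r_kind = M a \<Longrightarrow> Q (R', M)"
  shows "wp pop Q (R, M)"
  unfolding pop_def using assms(1-3) by simp (rule Q; simp add: add_numeral_Suc)

lemma wp_compare:
  assumes "R r1 = CNat a" "R r2 = CNat b" "r1 \<notin> {r_diff, r_tmp}" "r2 \<notin> {r_diff, r_tmp}"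
    and Q: "\<And>R' d. \<forall>r. r \<notin> {r_diff, r_tmp} \<longrightarrow> R' r = R r \<Longrightarrow> R' r_diff = CNat d \<Longrightarrow>
      (1 \<le> d \<longleftrightarrow> a \<noteq> b) \<Longrightarrow> Q (R', M)"
  shows "wp (compare r1 r2) Q (R, M)"
  unfolding compare_def using assms(1-4) by simp (rule Q[of _ "a - b + (b - a)"]; auto)

text \<open>Between distinct bounds, even infinite ones, lies a real number. If the bounds coincide,
  excluding the two infinities makes their common value real, and it is the witness.\<close>

lemma bounded_interval_nonempty:
  assumes "(m :: ereal) \<le> hi" "m \<noteq> \<infinity>" "hi \<noteq> - \<infinity>"
  shows "\<exists>v. m \<le> ereal v \<and> ereal v \<le> hi"
proof (cases "m < hi")
  case True
  then show ?thesis using ereal_dense2[of m hi] less_imp_le by blast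
next
  case False
  with assms show ?thesis by (cases hi) auto
qed

lemma half_open_interval_nonempty: "(\<exists>v. lo < ereal v \<and> ereal v \<le> hi) \<longleftrightarrow> lo < hi"
  using ereal_dense2[of lo hi] less_imp_le order_less_le_trans by blast

lemma wp_mark_if_nonempty:
  assumes R: "R r_one = CNat 1" "R r_out = CNat out" "R r_item = CNat i"
    and rep: "represents d (R r_item_tag) (R r_item_lo) (R r_item_hi) V"
    and Q: "\<And>R'. \<forall>r<12. R' r = R r \<Longrightarrow> Q (R', if V \<noteq> {} then M(out + i := CNat 1) else M)"
  shows "wp mark_if_nonempty Q (R, M)"
proof -
  have skip: "Q (R(r_tmp := CNat 2), M)" if "V = {}"
    using Q[of "R(r_tmp := CNat 2)"] that by simp
  have marked: "wp mark Q (R(r_tmp := CNat 2), M)" if "V \<noteq> {}"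
    unfolding mark_def using R Q[of "R(r_tmp := CNat (out + i))"] that by simp
  show ?thesis
  proof (cases d)
    case (Categorical D)
    with rep obtain S where "R r_item_tag = CNat 0" "R r_item_lo = CSet S" "V = CatVal ` S" by auto
    with skip marked R show ?thesis by (simp add: mark_if_nonempty_def)
  next
    case (Numerical m M')
    with rep consider
        (1) hi where "R r_item_tag = CNat 1" "m \<le> hi" "m \<noteq> \<infinity>" "hi \<noteq> - \<infinity>"
          "V = NumVal ` {v. m \<le> ereal v \<and> ereal v \<le> hi}"
      | (2) lo hi where "R r_item_tag = CNat 2" "R r_item_lo = CNum lo" "R r_item_hi = CNum hi"
          "V = NumVal ` {v. lo < ereal v \<and> ereal v \<le> hi}"
      by auto
    then show ?thesis
    proof cases
      case 1
      then have "V \<noteq> {}" using bounded_interval_nonempty[OF 1(2-4)] by blast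
      with marked R 1(1) show ?thesis by (simp add: mark_if_nonempty_def)
    next
      case 2
      then have "V \<noteq> {} \<longleftrightarrow> \<not> hi \<le> lo" using half_open_interval_nonempty[of lo hi] by auto
      with skip marked R 2(1-3) show ?thesis by (cases "hi \<le> lo") (simp_all add: mark_if_nonempty_def)
    qed
  qed
qed

lemma wp_check_leaf:
  assumes R: "R r_node = CNat a" "M (a + 1) = CNat c" "R r_class = CNat c0" "R r_one = CNat 1"
      "R r_out = CNat out" "R r_item = CNat i"
    and rep: "represents d (R r_item_tag) (R r_item_lo) (R r_item_hi) V"
    and Q: "\<And>R'. \<forall>r<12. R' r = R r \<Longrightarrow>
      Q (R', if V \<noteq> {} \<and> c \<noteq> c0 then M(out + i := CNat 1) else M)"
  shows "wp check_leaf Q (R, M)"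
proof -
  let ?R1 = "R(r_tmp := CNat (a + 1), r_feat := CNat c)"
  have "wp (compare r_feat r_class) (wp (Cond (TNatLe r_one r_diff) mark_if_nonempty Skip) Q) (?R1, M)"
  proof (rule wp_compare[where a = c and b = c0])
    fix R' d'
    assume R': "\<forall>r. r \<notin> {r_diff, r_tmp} \<longrightarrow> R' r = ?R1 r" "R' r_diff = CNat d'" "1 \<le> d' \<longleftrightarrow> c \<noteq> c0"
    have frame: "\<forall>r<12. R' r = R r" using R' by auto
    show "wp (Cond (TNatLe r_one r_diff) mark_if_nonempty Skip) Q (R', M)"
    proof (cases "c = c0")
      case True
      with R' frame R Q[OF frame] show ?thesis by simp
    next
      case False
      have "wp mark_if_nonempty Q (R', M)"
      proof (rule wp_mark_if_nonempty)
        show "represents d (R' r_item_tag) (R' r_item_lo) (R' r_item_hi) V" using rep frame by simp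
      next
        fix R'' assume "\<forall>r<12. R'' r = R' r"
        then have "\<forall>r<12. R'' r = R r" using frame by simp
        from Q[OF this] False show "Q (R'', if V \<noteq> {} then M(out + i := CNat 1) else M)" by simp
      qed (use frame R in simp_all)
      with False R' frame R show ?thesis by simp
    qed
  qed (use R in auto)
  then show ?thesis unfolding check_leaf_def using R by simp
qed

section \<open>Memory layout\<close>

definition cells_at :: "(nat \<Rightarrow> 'c cell) \<Rightarrow> nat \<Rightarrow> 'c cell list \<Rightarrow> bool" where
  "cells_at M a xs \<longleftrightarrow> (\<forall>j < length xs. M (a + j) = xs ! j)"

lemma cells_at_Nil [simp]: "cells_at M a []"
  by (simp add: cells_at_def)

lemma cells_at_Cons [simp]: "cells_at M a (x # xs) \<longleftrightarrow> M a = x \<and> cells_at M (Suc a) xs"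
  by (simp add: cells_at_def All_less_Suc2)

lemma cells_at_append [simp]:
  "cells_at M a (xs @ ys) \<longleftrightarrow> cells_at M a xs \<and> cells_at M (a + length xs) ys"
  by (induction xs arbitrary: a) auto

lemma cells_at_concat_map:
  assumes "cells_at M a (concat (map g xs))" "\<And>x. length (g x) = d" "i < length xs"
  shows "cells_at M (a + d * i) (g (xs ! i))"
  using assms(1,3)
proof (induction xs arbitrary: a i)
  case (Cons x xs)
  show ?case
  proof (cases i)
    case 0
    with Cons.prems show ?thesis by simp
  next
    case (Suc j)
    with Cons.IH[of "a + d" j] Cons.prems assms(2) show ?thesis by (simp add: ac_simps)
  qed
qed simp

text \<open>Keeps only the pointer structure of \<open>tree_cells\<close> inside the address range
  from \<open>lo\<close> to \<open>hi\<close> and forgets that subtrees are contiguous. This is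
  inherited by subtrees with the same range, as the invariants require.\<close>

fun tree_at :: "'f list \<Rightarrow> (nat \<Rightarrow> 'c cell) \<Rightarrow> nat \<Rightarrow> nat \<Rightarrow> ('f, 'c) dtree \<Rightarrow> nat \<Rightarrow> bool" where
  "tree_at fs M lo hi (Leaf c) a \<longleftrightarrow> lo \<le> a \<and> a + 2 \<le> hi \<and> M a = CNat 0 \<and> M (a + 1) = CNat c"
| "tree_at fs M lo hi (Node l t u) a \<longleftrightarrow> lo \<le> a \<and> a + 5 \<le> hi \<and>
     label_cells fs l = [M a, M (a + 1), M (a + 2)] \<and>
     (\<exists>b1 b2. M (a + 3) = CNat b1 \<and> M (a + 4) = CNat b2 \<and>
       tree_at fs M lo hi t b1 \<and> tree_at fs M lo hi u b2)"

lemma tree_at_cong: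
  "tree_at fs M lo hi T a \<Longrightarrow> (\<And>b. lo \<le> b \<Longrightarrow> b < hi \<Longrightarrow> M' b = M b) \<Longrightarrow> tree_at fs M' lo hi T a"
proof (induction T arbitrary: a)
  case (Node l t u)
  then show ?case by fastforce
qed auto

lemma length_label_cells [simp]: "length (label_cells fs l) = 3"
  by (cases l) auto

lemma label_cells_at:
  assumes "cells_at M a (label_cells fs l)"
  shows "label_cells fs l = [M a, M (a + 1), M (a + 2)]"
  using assms by (cases l) auto

lemma tree_at_tree_cells:
  assumes "cells_at M a (tree_cells fs a T)" "lo \<le> a" "a + length (tree_cells fs a T) \<le> hi"
  shows "tree_at fs M lo hi T a"
  using assms
proof (induction T arbitrary: a)
  case (Leaf c)
  then show ?case by simp
next
  case (Node l t u)
  let ?b = "a + 5 + length (tree_cells fs (a + 5) t)"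
  have cells: "cells_at M a (label_cells fs l)" "M (a + 3) = CNat (a + 5)" "M (a + 4) = CNat ?b"
    "cells_at M (a + 5) (tree_cells fs (a + 5) t)" "cells_at M ?b (tree_cells fs ?b u)"
    using Node.prems(1) by (simp_all add: Let_def add_numeral_Suc)
  have "tree_at fs M lo hi t (a + 5)" "tree_at fs M lo hi u ?b"
    using Node.prems cells by (auto intro!: Node.IH simp: Let_def)
  with cells(2,3) label_cells_at[OF cells(1)] Node.prems show ?case by (simp add: Let_def)
qed

lemma length_domain_cells [simp]: "length (domain_cells d) = 3"
  by (cases d) auto

lemma length_feature_table [simp]: "length (feature_table fs dm e) = 4 * length fs"
  unfolding feature_table_def by (induction fs) auto

lemma feature_table_at:
  assumes "cells_at M a (feature_table fs dm e)" "i < length fs"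
  shows "cells_at M (a + 4 * i) (domain_cells (dm (fs ! i)) @ [value_cell (e (fs ! i))])"
  using cells_at_concat_map[OF assms(1)[unfolded feature_table_def], of 4] assms(2) by simp

lemma position_nth: "distinct fs \<Longrightarrow> i < length fs \<Longrightarrow> position fs (fs ! i) = i"
  unfolding position_def by (rule the_equality) (auto simp: nth_eq_iff_index_eq)

lemma position_in_set:
  assumes "distinct fs" "x \<in> set fs"
  shows "position fs x < length fs" "fs ! position fs x = x"
proof -
  obtain i where "i < length fs" "fs ! i = x" using assms(2) by (auto simp: in_set_conv_nth)
  with position_nth[OF assms(1), of i] show "position fs x < length fs" "fs ! position fs x = x"
    by auto
qed

section \<open>Correctness\<close>

locale tree_input =
  fixes X :: "'f set" and dm :: "'f \<Rightarrow> 'c fdomain" and k :: nat and T :: "('f, 'c) dtree"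
    and e :: "'f \<Rightarrow> 'c fvalue" and fs :: "'f list"
  assumes space: "feature_space X dm" and tree: "decision_tree k X dm T"
    and entity: "e \<in> entities X dm" and distinct: "distinct fs" and set_fs: "set fs = X"
begin

abbreviation idx :: "'f \<Rightarrow> nat" where "idx \<equiv> position fs"

definition table_end :: nat where "table_end = 4 * length fs"

definition input_end :: nat where "input_end = length (input_cells fs dm T e)"

definition stack_bottom :: nat where "stack_bottom = input_end + length fs"

definition mem0 :: "nat \<Rightarrow> 'c cell" where "mem0 = snd (initial_state fs dm T e)"

text \<open>Refers to the initial memory, so that it survives every write; \<open>memory_ok\<close>
  says that the tree zone never changes and thus transfers it to the current memory.\<close>

definition subtree :: "('f, 'c) dtree \<Rightarrow> nat \<Rightarrow> bool" where
  "subtree w a \<longleftrightarrow> decision_tree k X dm w \<and> tree_at fs mem0 table_end input_end w a"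

text \<open>\<open>A\<close> is the family of value sets held in the table rows, and
  \<open>Mk\<close> the set of features flagged in the output zone. Nothing is said about addresses
  from \<open>stack_bottom\<close> on, which are free for the stack.\<close>

definition memory_ok :: "('f \<Rightarrow> 'c fvalue set) \<Rightarrow> 'f set \<Rightarrow> (nat \<Rightarrow> 'c cell) \<Rightarrow> bool" where
  "memory_ok A Mk M \<longleftrightarrow>
     (\<forall>x\<in>X. represents (dm x) (M (4 * idx x)) (M (4 * idx x + 1)) (M (4 * idx x + 2)) (A x) \<and>
        M (4 * idx x + 3) = value_cell (e x)) \<and>
     (\<forall>a. table_end \<le> a \<and> a < input_end \<longrightarrow> M a = mem0 a) \<and>
     (\<forall>x\<in>X. M (input_end + idx x) = CNat (if x \<in> Mk then 1 else 0))"

text \<open>A stack entry \<open>(w, x, V)\<close> stands for the entities \<open>e(x := v)\<close> with \<open>v \<in> V\<close>, which are those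
  that reach the subtree \<open>w\<close> and differ from \<open>e\<close> in \<open>x\<close> only. The stack grows upwards from behind
  the output, its top being the head of the list.\<close>

fun stack_at :: "(nat \<Rightarrow> 'c cell) \<Rightarrow> (('f, 'c) dtree \<times> 'f \<times> 'c fvalue set) list \<Rightarrow> nat \<Rightarrow> bool" where
  "stack_at M [] p \<longleftrightarrow> p = stack_bottom"
| "stack_at M ((w, x, V) # st) p \<longleftrightarrow>
     (\<exists>q a. p = q + 5 \<and> M q = CNat a \<and> subtree w a \<and> x \<in> X \<and> M (q + 1) = CNat (idx x) \<and>
       represents (dm x) (M (q + 2)) (M (q + 3)) (M (q + 4)) V \<and> stack_at M st q)"

text \<open>The comparison is with the class of the whole tree, since \<open>predict w e\<close> may
  be a different class once \<open>w\<close> lies off the path of \<open>e\<close>.\<close>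

definition flips :: "('f, 'c) dtree \<Rightarrow> 'f \<Rightarrow> 'c fvalue set \<Rightarrow> bool" where
  "flips w x V \<longleftrightarrow> (\<exists>v\<in>V. predict w (e(x := v)) \<noteq> predict T e)"

definition found :: "(('f, 'c) dtree \<times> 'f \<times> 'c fvalue set) list \<Rightarrow> 'f set" where
  "found st = {x. \<exists>w V. (w, x, V) \<in> set st \<and> flips w x V}"

definition weight :: "(('f, 'c) dtree \<times> 'f \<times> 'c fvalue set) list \<Rightarrow> nat" where
  "weight st = (\<Sum>it\<leftarrow>st. num_nodes (fst it))"

abbreviation necessary :: "'f set" where
  "necessary \<equiv> necessary_features X dm (predict T) e"

text \<open>The equation for \<open>necessary\<close> accounts for the entities
  \<open>e(x := v)\<close> according to whether they still follow the path, which leads into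
  \<open>w\<close>, or have left it, which leads into a stacked branch. The variant \<open>m\<close>
  adds up the nodes of all these subtrees.\<close>

definition walk_inv :: "nat \<Rightarrow> 'c state \<Rightarrow> bool" where
  "walk_inv m s \<longleftrightarrow> (\<exists>R M w A st a p. s = (R, M) \<and>
     R r_node = CNat a \<and> R r_out = CNat input_end \<and> R r_kind = M a \<and> R r_one = CNat 1 \<and>
     R r_sp = CNat p \<and> R r_bottom = CNat (Suc stack_bottom) \<and>
     subtree w a \<and> memory_ok A {} M \<and> stack_at M st p \<and> predict w e = predict T e \<and>
     necessary = {x \<in> X. flips w x (A x)} \<union> found st \<and> m = num_nodes w + weight st)"

text \<open>When the stack is empty, the equation says that the flags are the answer. The table rows
  now serve only to route \<open>e\<close>; that they represent some family \<open>A\<close> keeps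
  \<open>refine\<close> from getting stuck.\<close>

definition search_inv :: "nat \<Rightarrow> 'c state \<Rightarrow> bool" where
  "search_inv m s \<longleftrightarrow> (\<exists>R M A Mk st p. s = (R, M) \<and>
     R r_out = CNat input_end \<and> R r_one = CNat 1 \<and>
     R r_sp = CNat p \<and> R r_bottom = CNat (Suc stack_bottom) \<and> R r_class = CNat (predict T e) \<and>
     memory_ok A Mk M \<and> stack_at M st p \<and>
     necessary = Mk \<union> found st \<and> m = weight st)"

lemma walk_invI:
  assumes "R r_node = CNat a" "R r_out = CNat input_end" "R r_kind = M a"
      "R r_one = CNat 1" "R r_sp = CNat p" "R r_bottom = CNat (Suc stack_bottom)"
      "subtree w a" "memory_ok A {} M" "stack_at M st p" "predict w e = predict T e"
      "necessary = {x \<in> X. flips w x (A x)} \<union> found st" "m = num_nodes w + weight st"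
  shows "walk_inv m (R, M)"
  unfolding walk_inv_def using assms by blast

lemma walk_invE:
  assumes "walk_inv m s"
  obtains R M w A st a p where "s = (R, M)" "R r_node = CNat a" "R r_out = CNat input_end" "R r_kind = M a"
      "R r_one = CNat 1" "R r_sp = CNat p" "R r_bottom = CNat (Suc stack_bottom)"
      "subtree w a" "memory_ok A {} M" "stack_at M st p" "predict w e = predict T e"
      "necessary = {x \<in> X. flips w x (A x)} \<union> found st" "m = num_nodes w + weight st"
  using assms unfolding walk_inv_def by blast

lemma search_invI:
  assumes "R r_out = CNat input_end" "R r_one = CNat 1" "R r_sp = CNat p"
      "R r_bottom = CNat (Suc stack_bottom)" "R r_class = CNat (predict T e)"
      "memory_ok A Mk M" "stack_at M st p" "necessary = Mk \<union> found st" "m = weight st"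
  shows "search_inv m (R, M)"
  unfolding search_inv_def using assms by blast

lemma search_invE:
  assumes "search_inv m s"
  obtains R M A Mk st p where "s = (R, M)" "R r_out = CNat input_end" "R r_one = CNat 1" "R r_sp = CNat p"
      "R r_bottom = CNat (Suc stack_bottom)" "R r_class = CNat (predict T e)"
      "memory_ok A Mk M" "stack_at M st p" "necessary = Mk \<union> found st" "m = weight st"
  using assms unfolding search_inv_def by blast

section \<open>Separation of the memory zones: table, tree, output, stack\<close>

lemma idx_less: "x \<in> X \<Longrightarrow> idx x < length fs"
  using position_in_set(1) distinct set_fs by metis

lemma idx_eq_iff: "x \<in> X \<Longrightarrow> y \<in> X \<Longrightarrow> idx x = idx y \<longleftrightarrow> x = y"
  using position_in_set(2) distinct set_fs by metis

lemma table_end_le: "table_end \<le> input_end"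
  by (simp add: table_end_def input_end_def input_cells_def)

lemma row_less: "x \<in> X \<Longrightarrow> 4 * idx x + 4 \<le> table_end"
  using idx_less[of x] by (simp add: table_end_def)

lemma stack_at_ge: "stack_at M st p \<Longrightarrow> stack_bottom \<le> p"
  by (induction M st p rule: stack_at.induct) fastforce+

lemma stack_at_cong:
  "stack_at M st p \<Longrightarrow> (\<And>a. stack_bottom \<le> a \<Longrightarrow> a < p \<Longrightarrow> M' a = M a) \<Longrightarrow> stack_at M' st p"
proof (induction M st p rule: stack_at.induct)
  case (2 M w x V st p)
  from "2.prems"(1) obtain q a where q: "p = q + 5" "M q = CNat a" "subtree w a" "x \<in> X"
    "M (q + 1) = CNat (idx x)" "represents (dm x) (M (q + 2)) (M (q + 3)) (M (q + 4)) V"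
    "stack_at M st q" by auto
  have "stack_at M' st q" using "2.IH"[OF q(7)] "2.prems"(2) q(1) by simp
  moreover have "M' (q + j) = M (q + j)" if "j < 5" for j
    using "2.prems"(2) stack_at_ge[OF q(7)] that q(1) by simp
  from this[of 0] this[of 1] this[of 2] this[of 3] this[of 4]
  have "M' q = M q" "M' (q + 1) = M (q + 1)" "M' (q + 2) = M (q + 2)" "M' (q + 3) = M (q + 3)"
    "M' (q + 4) = M (q + 4)" by simp_all
  ultimately show ?case using q by auto
qed simp

lemma memory_ok_cong:
  assumes "memory_ok A Mk M" "\<And>a. a < stack_bottom \<Longrightarrow> M' a = M a"
  shows "memory_ok A Mk M'"
proof -
  have "M' (4 * idx x + j) = M (4 * idx x + j)" if "x \<in> X" "j < 4" for x j
    using assms(2) row_less[OF that(1)] that(2) table_end_le by (simp add: stack_bottom_def)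
  from this[of _ 0] this[of _ 1] this[of _ 2] this[of _ 3]
  have "M' (4 * idx x) = M (4 * idx x)" "M' (4 * idx x + 1) = M (4 * idx x + 1)"
    "M' (4 * idx x + 2) = M (4 * idx x + 2)" "M' (4 * idx x + 3) = M (4 * idx x + 3)"
    if "x \<in> X" for x using that by simp_all
  moreover have "M' (input_end + idx x) = M (input_end + idx x)" if "x \<in> X" for x
    using assms(2) idx_less[OF that] by (simp add: stack_bottom_def)
  moreover have "M' a = M a" if "a < input_end" for a
    using assms(2) that by (simp add: stack_bottom_def)
  ultimately show ?thesis using assms(1) unfolding memory_ok_def by simp
qed

lemma memory_ok_push:
  assumes "memory_ok A Mk M" "stack_bottom \<le> p"
  shows "memory_ok A Mk (M(p := c0, p + 1 := c1, p + 2 := c2, p + 3 := c3, p + 4 := c4))"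
  using assms(2) by (intro memory_ok_cong[OF assms(1)]) simp

lemma stack_at_push:
  assumes "stack_at M st p" "subtree w a" "x \<in> X" "represents (dm x) c2 c3 c4 V"
  shows "stack_at (M(p := CNat a, p + 1 := CNat (idx x), p + 2 := c2, p + 3 := c3, p + 4 := c4))
           ((w, x, V) # st) (p + 5)"
  (is "stack_at ?M _ _")
proof -
  have "stack_at ?M st p" by (rule stack_at_cong[OF assms(1)]) simp
  with assms(2-4) show ?thesis by (simp del: One_nat_def)
qed

lemma memory_ok_row:
  assumes "memory_ok A Mk M" "x \<in> X" "represents (dm x) c0 c1 c2 V"
  shows "memory_ok (A(x := V)) Mk (M(4 * idx x := c0, 4 * idx x + 1 := c1, 4 * idx x + 2 := c2))"
    (is "memory_ok _ _ ?M")
proof -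
  have other: "?M (4 * idx y + j) = M (4 * idx y + j)" if "y \<in> X" "y \<noteq> x" "j < 4" for y j
  proof -
    have "idx y \<noteq> idx x" using that assms(2) idx_eq_iff by blast
    \<comment> \<open>Different rows start at least four cells apart, so offsets below 4 cannot
      meet.\<close>
    with that(3) have "4 * idx y + j \<noteq> 4 * idx x + i" if "i < 4" for i
      using that by presburger
    from this[of 0] this[of 1] this[of 2] show ?thesis by simp
  qed
  from this[of _ 0] this[of _ 1] this[of _ 2] this[of _ 3]
  have row: "?M (4 * idx y) = M (4 * idx y)" "?M (4 * idx y + 1) = M (4 * idx y + 1)"
    "?M (4 * idx y + 2) = M (4 * idx y + 2)" "?M (4 * idx y + 3) = M (4 * idx y + 3)"
    if "y \<in> X" "y \<noteq> x" for y using that by simp_all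
  have same: "?M (4 * idx x) = c0" "?M (4 * idx x + 1) = c1" "?M (4 * idx x + 2) = c2"
    "?M (4 * idx x + 3) = M (4 * idx x + 3)" by simp_all
  have beyond: "?M a = M a" if "table_end \<le> a" for a
    using row_less[OF assms(2)] that by simp
  have "represents (dm y) (?M (4 * idx y)) (?M (4 * idx y + 1)) (?M (4 * idx y + 2)) ((A(x := V)) y) \<and>
      ?M (4 * idx y + 3) = value_cell (e y)" if "y \<in> X" for y
  proof (cases "y = x")
    case True
    then show ?thesis using same assms unfolding memory_ok_def by simp
  next
    case False
    then show ?thesis using row[OF that False] assms(1) that unfolding memory_ok_def by simp
  qed
  moreover have "?M a = mem0 a" if "table_end \<le> a" "a < input_end" for a
    using beyond that assms(1) unfolding memory_ok_def by simp
  moreover have "?M (input_end + idx y) = CNat (if y \<in> Mk then 1 else 0)" if "y \<in> X" for y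
    using beyond[of "input_end + idx y"] table_end_le that assms(1) unfolding memory_ok_def by simp
  ultimately show ?thesis unfolding memory_ok_def by blast
qed

lemma memory_ok_mark:
  assumes "memory_ok A Mk M" "x \<in> X"
  shows "memory_ok A (insert x Mk) (M(input_end + idx x := CNat 1))"
proof -
  have "4 * idx y + j \<noteq> input_end + idx x" if "y \<in> X" "j < 4" for y j
    using row_less[OF that(1)] that(2) table_end_le by linarith
  from this[of _ 0] this[of _ 1] this[of _ 2] this[of _ 3]
  have "4 * idx y \<noteq> input_end + idx x" "4 * idx y + 1 \<noteq> input_end + idx x"
    "4 * idx y + 2 \<noteq> input_end + idx x" "4 * idx y + 3 \<noteq> input_end + idx x" if "y \<in> X" for y
    using that by simp_all
  then show ?thesis
    using assms idx_eq_iff unfolding memory_ok_def by (simp del: One_nat_def)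
qed

lemma stack_at_below:
  assumes "stack_at M st p" "a < stack_bottom"
  shows "stack_at (M(a := c)) st p"
  using assms(2) by (intro stack_at_cong[OF assms(1)]) simp

section \<open>How changes of one feature branch at a node\<close>

lemma found_simps [simp]:
  "found [] = {}"
  "found ((w, x, V) # st) = (if flips w x V then insert x (found st) else found st)"
  by (auto simp: found_def)

lemma weight_simps [simp]: "weight [] = 0" "weight ((w, x, V) # st) = num_nodes w + weight st"
  by (simp_all add: weight_def)

lemma flips_Leaf: "flips (Leaf c) x V \<longleftrightarrow> V \<noteq> {} \<and> c \<noteq> predict T e"
  by (auto simp: flips_def)

text \<open>Here \<open>s\<close> is the child that \<open>e\<close> enters and \<open>d\<close> the
  other one. Changing a feature other than \<open>feature l\<close> does not affect the literal, so
  the path still goes to \<open>s\<close>; for \<open>feature l\<close> the new value alone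
  decides.\<close>

lemma flips_Node:
  assumes "satisfies e l \<Longrightarrow> s = t \<and> d = u" "\<not> satisfies e l \<Longrightarrow> s = u \<and> d = t"
  shows "flips (Node l t u) x V \<longleftrightarrow>
    (if x = feature l
     then flips s x {v \<in> V. holds l v = holds l (e (feature l))} \<or>
          flips d x {v \<in> V. holds l v \<noteq> holds l (e (feature l))}
     else flips s x V)"
  using assms by (cases "satisfies e l") (auto simp: flips_def satisfies_iff split: if_splits)

text \<open>Only a change at \<open>feature l\<close> can leave the path at this node, so a node of
  the path gives rise to exactly one stack entry and narrows exactly one set of
  \<open>A\<close>.\<close>

lemma flipping_features_Node:
  assumes "satisfies e l \<Longrightarrow> s = t \<and> d = u" "\<not> satisfies e l \<Longrightarrow> s = u \<and> d = t" "feature l \<in> X"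
  shows "{x \<in> X. flips (Node l t u) x (A x)} \<union> found st =
    {x \<in> X. flips s x ((A(feature l := {v \<in> A (feature l). holds l v = holds l (e (feature l))})) x)} \<union>
    found ((d, feature l, {v \<in> A (feature l). holds l v \<noteq> holds l (e (feature l))}) # st)"
  using assms(3) by (auto simp: flips_Node[OF assms(1,2)] split: if_splits)

section \<open>Reading tree nodes from the current memory\<close>

lemma subtree_in_memory: "subtree w a \<Longrightarrow> memory_ok A Mk M \<Longrightarrow> tree_at fs M table_end input_end w a"
  unfolding subtree_def memory_ok_def by (elim conjE, erule tree_at_cong) simp

lemma kind_of_Node:
  assumes "subtree (Node l t u) a" "memory_ok A Mk M"
  shows "\<exists>j\<ge>1. M a = CNat j"
proof -
  have "M a = label_cells fs l ! 0" using subtree_in_memory[OF assms] by simp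
  then show ?thesis by (cases l) simp_all
qed

lemma subtree_ge: "subtree w a \<Longrightarrow> table_end \<le> a \<and> a < input_end"
  by (cases w) (auto simp: subtree_def)

lemma label_feature:
  assumes "subtree (Node l t u) a"
  shows "label_over X dm l" "feature l \<in> X" "e (feature l) \<in> domain_values (dm (feature l))"
proof -
  show "label_over X dm l" using assms by (simp add: subtree_def)
  then show "feature l \<in> X" by (cases l) auto
  then show "e (feature l) \<in> domain_values (dm (feature l))"
    using entity by (auto simp: entities_def)
qed

lemma wp_visit_node:
  assumes mem: "memory_ok A Mk M" and node: "subtree (Node l t u) a"
    and R: "R r_node = CNat a" "R r_one = CNat 1" "R r_kind = M a"
    and Q: "\<And>R' b1 b2. \<forall>r<13. R' r = R r \<Longrightarrow> R' r_feat = CNat (idx (feature l)) \<Longrightarrow>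
      label_cells fs l = [R' r_kind, R' r_feat, R' r_datum] \<Longrightarrow>
      R' r_stay = CNat b1 \<Longrightarrow> R' r_off = CNat b2 \<Longrightarrow> subtree t b1 \<Longrightarrow> subtree u b2 \<Longrightarrow>
      R' r_row = CNat (4 * idx (feature l)) \<Longrightarrow>
      represents (dm (feature l)) (R' r_tag) (R' r_lo) (R' r_hi) (A (feature l)) \<Longrightarrow>
      R' r_val = value_cell (e (feature l)) \<Longrightarrow> Q (R', M)"
  shows "wp visit Q (R, M)"
proof -
  let ?x = "feature l"
  have dt: "decision_tree k X dm t" "decision_tree k X dm u" using node by (auto simp: subtree_def)
  have at0: "tree_at fs mem0 table_end input_end (Node l t u) a" using node by (simp add: subtree_def)
  have same: "M b = mem0 b" if "table_end \<le> b" "b < input_end" for b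
    using mem that by (simp add: memory_ok_def)
  from at0 obtain b1 b2 where b: "mem0 (a + 3) = CNat b1" "mem0 (a + 4) = CNat b2"
      "tree_at fs mem0 table_end input_end t b1" "tree_at fs mem0 table_end input_end u b2"
      "label_cells fs l = [mem0 a, mem0 (a + 1), mem0 (a + 2)]" "table_end \<le> a" "a + 5 \<le> input_end"
    by auto
  have M: "M a = mem0 a" "M (a + 1) = mem0 (a + 1)" "M (a + 2) = mem0 (a + 2)"
    "M (a + 3) = mem0 (a + 3)" "M (a + 4) = mem0 (a + 4)"
    using b(6,7) by (auto intro!: same)
  have "M (a + 1) = CNat (idx ?x)" using b(5) M(2) by (cases l) auto
  then show ?thesis
  proof (rule wp_visit[OF R(1,2)])
    fix R'
    assume R': "\<forall>r<13. R' r = R r" "R' r_feat = CNat (idx ?x)" "R' r_datum = M (a + 2)"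
      "R' r_stay = M (a + 3)" "R' r_off = M (a + 4)" "R' r_row = CNat (4 * idx ?x)"
      "R' r_tag = M (4 * idx ?x)" "R' r_lo = M (4 * idx ?x + 1)" "R' r_hi = M (4 * idx ?x + 2)"
      "R' r_val = M (4 * idx ?x + 3)"
    show "Q (R', M)"
    proof (rule Q[where ?b1.0 = b1 and ?b2.0 = b2])
      show "label_cells fs l = [R' r_kind, R' r_feat, R' r_datum]"
        using b(5) M R' R(3) \<open>M (a + 1) = CNat (idx ?x)\<close> by simp
      show "represents (dm ?x) (R' r_tag) (R' r_lo) (R' r_hi) (A ?x)"
        "R' r_val = value_cell (e ?x)"
        using mem label_feature(2)[OF node] R'(7-10) unfolding memory_ok_def by simp_all
      show "subtree t b1" "subtree u b2" using b dt by (simp_all add: subtree_def)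
    qed (use R' b M in simp_all)
  qed
qed

section \<open>Preservation of the two loop invariants\<close>

lemma walk_step:
  assumes inv: "walk_inv m s" and test: "eval_test (TNatLe r_one r_kind) s = Some True"
  shows "wp walk_body (\<lambda>s'. \<exists>m'<m. walk_inv m' s') s"
proof -
  from inv obtain R M w A st a p where s: "s = (R, M)" and I: "R r_node = CNat a"
      "R r_out = CNat input_end" "R r_kind = M a" "R r_one = CNat 1" "R r_sp = CNat p"
      "R r_bottom = CNat (Suc stack_bottom)"
    and w: "subtree w a" and mem: "memory_ok A {} M" and stack: "stack_at M st p"
    and pred: "predict w e = predict T e"
    and nec: "necessary = {x \<in> X. flips w x (A x)} \<union> found st"
    and m: "m = num_nodes w + weight st"
    by (rule walk_invE)
  obtain l t u where node: "w = Node l t u"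
    using subtree_in_memory[OF w mem] test I(3,4) s by (cases w) auto
  note w = w[unfolded node]
  let ?x = "feature l"
  let ?sat = "holds l (e ?x)"
  let ?stay = "{v \<in> A ?x. holds l v = ?sat}" and ?off = "{v \<in> A ?x. holds l v \<noteq> ?sat}"
  let ?s = "if ?sat then t else u" and ?d = "if ?sat then u else t"
  show ?thesis
    unfolding s walk_body_def wp.simps(3)
  proof (rule wp_visit_node[OF mem w I(1,4,3)])
    fix R1 b1 b2
    assume R1: "\<forall>r<13. R1 r = R r" "R1 r_feat = CNat (idx ?x)"
      "R1 r_stay = CNat b1" "R1 r_off = CNat b2" "R1 r_row = CNat (4 * idx ?x)"
      and val: "R1 r_val = value_cell (e ?x)"
      and cells: "label_cells fs l = [R1 r_kind, R1 r_feat, R1 r_datum]"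
      and repA: "represents (dm ?x) (R1 r_tag) (R1 r_lo) (R1 r_hi) (A ?x)"
      and sub: "subtree t b1" "subtree u b2"
    show "wp refine (wp (push r_off r_feat r_off_tag r_off_lo r_off_hi)
        (wp advance (\<lambda>s'. \<exists>m'<m. walk_inv m' s'))) (R1, M)"
    proof (rule wp_refine[OF repA label_feature(1)[OF w] cells val label_feature(3)[OF w]])
      fix R2
      assume R2: "\<forall>r. r < 13 \<or> r = r_feat \<or> r = r_row \<longrightarrow> R2 r = R1 r"
        "R2 r_stay = (if ?sat then R1 r_stay else R1 r_off)"
        "R2 r_off = (if ?sat then R1 r_off else R1 r_stay)"
        and rep: "represents (dm ?x) (R2 r_stay_tag) (R2 r_stay_lo) (R2 r_stay_hi) ?stay"
          "represents (dm ?x) (R2 r_off_tag) (R2 r_off_lo) (R2 r_off_hi) ?off"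
      \<comment> \<open>The addresses of the child that \<open>e\<close> enters and of the branch
        left behind.\<close>
      define bs bd where "bs = (if ?sat then b1 else b2)" and "bd = (if ?sat then b2 else b1)"
      have sub': "subtree ?s bs" "subtree ?d bd" using sub by (simp_all add: bs_def bd_def)
      have R2': "R2 r_out = CNat input_end" "R2 r_one = CNat 1" "R2 r_sp = CNat p"
        "R2 r_bottom = CNat (Suc stack_bottom)" "R2 r_feat = CNat (idx ?x)"
        "R2 r_row = CNat (4 * idx ?x)" "R2 r_stay = CNat bs" "R2 r_off = CNat bd"
        using R2 R1 I by (simp_all add: bs_def bd_def)
      let ?M1 = "M(p := R2 r_off, p + 1 := R2 r_feat, p + 2 := R2 r_off_tag, p + 3 := R2 r_off_lo,
        p + 4 := R2 r_off_hi)"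
      have x: "?x \<in> X" using label_feature(2)[OF w] .
      have row: "4 * idx ?x + 4 \<le> table_end" using row_less[OF x] .
      have below: "table_end \<le> bs" "bs < input_end" using subtree_ge[OF sub'(1)] by auto
      show "wp (push r_off r_feat r_off_tag r_off_lo r_off_hi)
          (wp advance (\<lambda>s'. \<exists>m'<m. walk_inv m' s')) (R2, M)"
      proof (rule wp_push[OF R2'(3,2)], goal_cases)
        case 2
        show ?case
        proof (rule wp_advance[where i = "4 * idx ?x" and b = bs], goal_cases)
          case (5 R3)
          let ?M2 = "?M1(4 * idx ?x := R2 r_stay_tag, 4 * idx ?x + 1 := R2 r_stay_lo,
            4 * idx ?x + 2 := R2 r_stay_hi)"
          have p: "stack_bottom \<le> p" using stack_at_ge[OF stack] .
          have mem2: "memory_ok (A(?x := ?stay)) {} ?M2"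
            using memory_ok_row[OF memory_ok_push[OF mem p] x rep(1)] .
          have "stack_at ?M1 ((?d, ?x, ?off) # st) (p + 5)"
            using stack_at_push[OF stack sub'(2) x rep(2)] R2'(5,8) by simp
          then have stack2: "stack_at ?M2 ((?d, ?x, ?off) # st) (p + 5)"
            using row table_end_le by (elim stack_at_cong) (simp add: stack_bottom_def)
          \<comment> \<open>\<open>wp_advance\<close> speaks of the memory before the row is
            overwritten; \<open>bs\<close> lies beyond the table, so both memories agree
            there.\<close>
          have kind: "R3 r_kind = ?M2 bs" using 5(3) row below by simp
          have pred2: "predict ?s e = predict T e"
            using pred by (simp add: node satisfies_iff split: if_splits)
          have nec2: "necessary = {x \<in> X. flips ?s x ((A(?x := ?stay)) x)} \<union> found ((?d, ?x, ?off) # st)"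
            unfolding nec node using x
            by (intro flipping_features_Node[where A = A and l = l and s = ?s and d = ?d])
              (simp_all add: satisfies_iff)
          have R3: "R3 r_node = CNat bs" "R3 r_out = CNat input_end" "R3 r_one = CNat 1"
            "R3 r_sp = CNat (p + 5)" "R3 r_bottom = CNat (Suc stack_bottom)"
            using 5(1,2) R2'(1-4) by simp_all
          have "walk_inv (num_nodes ?s + weight ((?d, ?x, ?off) # st)) (R3, ?M2)"
            using walk_invI[OF R3(1,2) kind R3(3-5) sub'(1) mem2 stack2 pred2 nec2 refl] .
          \<comment> \<open>The two children share all nodes of \<open>w\<close> except its
            root.\<close>
          moreover have "num_nodes ?s + weight ((?d, ?x, ?off) # st) < m"
            by (simp add: m node)
          ultimately have "\<exists>m'<m. walk_inv m' (R3, ?M2)" by blast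
          then show ?case by simp
        qed (use R2' row below in simp_all)
      qed simp
    qed
  qed
qed

text \<open>One stack entry gives way to one or two entries for its children. The continuation sees
  only that \<open>found\<close> is kept and \<open>weight\<close> drops, so both cases look alike
  to the search loop; the root always leaves the weight.\<close>

lemma wp_expand_node:
  assumes mem: "memory_ok A Mk M" and stack: "stack_at M st q"
    and node: "subtree (Node l t u) a" and x: "x \<in> X"
    and rep: "represents (dm x) (R r_item_tag) (R r_item_lo) (R r_item_hi) V"
    and R: "R r_node = CNat a" "R r_one = CNat 1" "R r_kind = M a" "R r_item = CNat (idx x)"
      "R r_sp = CNat q"
    and Q: "\<And>R' M' st' p. \<forall>r\<in>{r_out, r_one, r_bottom, r_class}. R' r = R r \<Longrightarrow> R' r_sp = CNat p \<Longrightarrow>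
      memory_ok A Mk M' \<Longrightarrow> stack_at M' st' p \<Longrightarrow> found st' = found ((Node l t u, x, V) # st) \<Longrightarrow>
      weight st' < weight ((Node l t u, x, V) # st) \<Longrightarrow> Q (R', M')"
  shows "wp expand_node Q (R, M)"
  unfolding expand_node_def wp.simps(3)
proof (rule wp_visit_node[OF mem node R(1-3)], rule wp_compare[where a = "idx (feature l)" and b = "idx x"])
  let ?x = "feature l"
  let ?sat = "holds l (e ?x)"
  let ?s = "if ?sat then t else u" and ?d = "if ?sat then u else t"
  have q: "stack_bottom \<le> q" using stack_at_ge[OF stack] .
  note label = label_feature[OF node]
  fix R1 b1 b2 R2 d
  assume R1: "\<forall>r<13. R1 r = R r" "R1 r_stay = CNat b1" "R1 r_off = CNat b2"
      "R1 r_val = value_cell (e ?x)" "label_cells fs l = [R1 r_kind, R1 r_feat, R1 r_datum]"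
    and repA: "represents (dm ?x) (R1 r_tag) (R1 r_lo) (R1 r_hi) (A ?x)"
    and sub: "subtree t b1" "subtree u b2"
    and R2: "\<forall>r. r \<notin> {r_diff, r_tmp} \<longrightarrow> R2 r = R1 r" "R2 r_diff = CNat d" "1 \<le> d \<longleftrightarrow> idx ?x \<noteq> idx x"
  define bs bd where "bs = (if ?sat then b1 else b2)" and "bd = (if ?sat then b2 else b1)"
  have sub': "subtree ?s bs" "subtree ?d bd" using sub by (simp_all add: bs_def bd_def)
  have flips: "flips (Node l t u) y W \<longleftrightarrow>
      (if y = ?x then flips ?s y {v \<in> W. holds l v = ?sat} \<or> flips ?d y {v \<in> W. holds l v \<noteq> ?sat}
       else flips ?s y W)" for y W
    by (rule flips_Node) (auto simp: satisfies_iff)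
  let ?push = "Cond (TNatLe r_one r_diff)
           (push r_stay r_item r_item_tag r_item_lo r_item_hi)
           (Seq (push r_stay r_item r_stay_tag r_stay_lo r_stay_hi)
                (push r_off r_item r_off_tag r_off_lo r_off_hi))"
  show "wp (Cond (TNatLe r_one r_diff) Skip
           (straight [IMove r_tag r_item_tag, IMove r_lo r_item_lo, IMove r_hi r_item_hi]))
         (wp refine (wp ?push Q)) (R2, M)"
  proof (cases "?x = x")
    case True
    with R2(3) have d: "\<not> 1 \<le> d" by simp
    let ?R3 = "R2(r_tag := R r_item_tag, r_lo := R r_item_lo, r_hi := R r_item_hi)"
    have "wp refine (wp ?push Q) (?R3, M)"
    proof (rule wp_refine[where l = l and v = "e ?x" and X = X and V = V])
      fix R4
      assume R4: "\<forall>r. r < 13 \<or> r = r_feat \<or> r = r_row \<longrightarrow> R4 r = ?R3 r"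
        "R4 r_stay = (if ?sat then ?R3 r_stay else ?R3 r_off)"
        "R4 r_off = (if ?sat then ?R3 r_off else ?R3 r_stay)"
        and rep4: "represents (dm ?x) (R4 r_stay_tag) (R4 r_stay_lo) (R4 r_stay_hi) {v \<in> V. holds l v = ?sat}"
          "represents (dm ?x) (R4 r_off_tag) (R4 r_off_lo) (R4 r_off_hi) {v \<in> V. holds l v \<noteq> ?sat}"
      have R4': "R4 r_diff = CNat d" "R4 r_one = CNat 1" "R4 r_sp = CNat q" "R4 r_item = CNat (idx x)"
        "R4 r_stay = CNat bs" "R4 r_off = CNat bd" "\<forall>r\<in>{r_out, r_one, r_bottom, r_class}. R4 r = R r"
        using R4 R2 R1 R by (simp_all add: bs_def bd_def)
      let ?M1 = "M(q := R4 r_stay, q + 1 := R4 r_item, q + 2 := R4 r_stay_tag, q + 3 := R4 r_stay_lo,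
        q + 4 := R4 r_stay_hi)"
      let ?p = "q + 5"
      let ?M2 = "?M1(?p := R4 r_off, ?p + 1 := R4 r_item, ?p + 2 := R4 r_off_tag, ?p + 3 := R4 r_off_lo,
        ?p + 4 := R4 r_off_hi)"
      let ?st1 = "(?s, x, {v \<in> V. holds l v = ?sat}) # st"
      let ?st2 = "(?d, x, {v \<in> V. holds l v \<noteq> ?sat}) # ?st1"
      have mem2: "memory_ok A Mk ?M2"
        using q by (intro memory_ok_push mem) auto
      have stack1: "stack_at ?M1 ?st1 ?p"
        using stack_at_push[OF stack sub'(1) x rep4(1)[unfolded True]] unfolding R4'(4,5) True .
      have stack2: "stack_at ?M2 ?st2 (?p + 5)"
        using stack_at_push[OF stack1 sub'(2) x rep4(2)[unfolded True]] unfolding R4'(4,6) True .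
      have "found ?st2 = found ((Node l t u, x, V) # st)"
        using True by (simp add: flips)
      moreover have "weight ?st2 < weight ((Node l t u, x, V) # st)" by simp
      ultimately have Q2: "Q (R4(r_sp := CNat (?p + 5)), ?M2)"
        using R4'(7) by (intro Q[OF _ _ mem2 stack2]) simp_all
      have Q1: "wp (push r_off r_item r_off_tag r_off_lo r_off_hi) Q (R4(r_sp := CNat ?p), ?M1)"
        by (rule wp_push[where p = ?p]) (use R4'(2) Q2 in simp_all)
      have "wp (push r_stay r_item r_stay_tag r_stay_lo r_stay_hi)
          (wp (push r_off r_item r_off_tag r_off_lo r_off_hi) Q) (R4, M)"
        by (rule wp_push[OF R4'(3,2)]) (use Q1 in simp_all)
      then show "wp ?push Q (R4, M)" using R4' d by simp
    qed (use label R1 R2 rep True in simp_all)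
    then show ?thesis using d R2 R1 R by simp
  next
    case False
    with R2(3) idx_eq_iff[OF label(2) x] have d: "1 \<le> d" by simp
    have "wp refine (wp ?push Q) (R2, M)"
    \<comment> \<open>The row set \<open>A ?x\<close> only lets \<open>refine\<close> run; of its
      result just the address in \<open>r_stay\<close> is used.\<close>
    proof (rule wp_refine[where l = l and v = "e ?x" and X = X and V = "A ?x"])
      fix R4
      assume R4: "\<forall>r. r < 13 \<or> r = r_feat \<or> r = r_row \<longrightarrow> R4 r = R2 r"
        "R4 r_stay = (if ?sat then R2 r_stay else R2 r_off)"
      have R4': "R4 r_diff = CNat d" "R4 r_one = CNat 1" "R4 r_sp = CNat q" "R4 r_item = CNat (idx x)"
        "R4 r_stay = CNat bs" "\<forall>r\<in>{r_out, r_one, r_bottom, r_class}. R4 r = R r"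
        "R4 r_item_tag = R r_item_tag" "R4 r_item_lo = R r_item_lo" "R4 r_item_hi = R r_item_hi"
        using R4 R2 R1 R by (simp_all add: bs_def)
      let ?M1 = "M(q := R4 r_stay, q + 1 := R4 r_item, q + 2 := R4 r_item_tag, q + 3 := R4 r_item_lo,
        q + 4 := R4 r_item_hi)"
      have mem1: "memory_ok A Mk ?M1" using q by (intro memory_ok_push mem)
      have stack1: "stack_at ?M1 ((?s, x, V) # st) (q + 5)"
        using stack_at_push[OF stack sub'(1) x rep] unfolding R4'(4,5,7-9) .
      have "found ((?s, x, V) # st) = found ((Node l t u, x, V) # st)"
        using False by (simp add: flips)
      moreover have "weight ((?s, x, V) # st) < weight ((Node l t u, x, V) # st)" by simp
      ultimately have Q1: "Q (R4(r_sp := CNat (q + 5)), ?M1)"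
        using R4'(6) by (intro Q[OF _ _ mem1 stack1]) simp_all
      have "wp (push r_stay r_item r_item_tag r_item_lo r_item_hi) Q (R4, M)"
        by (rule wp_push[OF R4'(3,2)]) (use Q1 in simp_all)
      then show "wp ?push Q (R4, M)" using R4' d by simp
    qed (use label R1 R2 repA in simp_all)
    then show ?thesis using d R2 R1 R by simp
  qed
qed (use R in simp_all)

lemma search_step:
  assumes inv: "search_inv m s" and test: "eval_test (TNatLe r_bottom r_sp) s = Some True"
  shows "wp search_body (\<lambda>s'. \<exists>m'<m. search_inv m' s') s"
proof -
  from inv obtain R M A Mk st p where s: "s = (R, M)"
    and I: "R r_out = CNat input_end" "R r_one = CNat 1" "R r_sp = CNat p"
      "R r_bottom = CNat (Suc stack_bottom)" "R r_class = CNat (predict T e)"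
    and mem: "memory_ok A Mk M" and stack: "stack_at M st p"
    and nec: "necessary = Mk \<union> found st" and m: "m = weight st"
    by (rule search_invE)
  \<comment> \<open>The pointer of an empty stack is \<open>stack_bottom\<close>, one less than the
    test demands.\<close>
  obtain w x V st0 where st: "st = (w, x, V) # st0"
    using stack test I s by (cases st) auto
  from stack[unfolded st] obtain q a where q: "p = q + 5" "M q = CNat a" "subtree w a" "x \<in> X"
      "M (q + 1) = CNat (idx x)" "represents (dm x) (M (q + 2)) (M (q + 3)) (M (q + 4)) V"
    and stack0: "stack_at M st0 q"
    by auto
  show ?thesis unfolding s search_body_def wp.simps(3)
  proof (rule wp_pop[where R = R and M = M and q = q and a = a, OF I(3)[unfolded q(1)] I(2) q(2)])
    fix R1
    assume R1: "\<forall>r\<in>{r_out, r_one, r_bottom, r_class}. R1 r = R r" "R1 r_sp = CNat q"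
      "R1 r_node = CNat a" "R1 r_item = M (q + 1)" "R1 r_item_tag = M (q + 2)"
      "R1 r_item_lo = M (q + 3)" "R1 r_item_hi = M (q + 4)" "R1 r_kind = M a"
    have rep: "represents (dm x) (R1 r_item_tag) (R1 r_item_lo) (R1 r_item_hi) V"
      using q(6) R1(5-7) by simp
    have R1': "R1 r_out = CNat input_end" "R1 r_one = CNat 1" "R1 r_bottom = CNat (Suc stack_bottom)"
      "R1 r_class = CNat (predict T e)" "R1 r_item = CNat (idx x)"
      using R1 I q by simp_all
    show "wp (Cond (TNatLe r_one r_kind) expand_node check_leaf) (\<lambda>s'. \<exists>m'<m. search_inv m' s') (R1, M)"
    proof (cases w)
      case (Leaf c)
      with subtree_in_memory[OF q(3) mem] have leaf: "M a = CNat 0" "M (a + 1) = CNat c" by simp_all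
      have "wp check_leaf (\<lambda>s'. \<exists>m'<m. search_inv m' s') (R1, M)"
      proof (rule wp_check_leaf[where R = R1 and M = M and a = a, OF R1(3) leaf(2) R1'(4,2,1,5) rep])
        fix R2
        assume R2: "\<forall>r<12. R2 r = R1 r"
        let ?hit = "V \<noteq> {} \<and> c \<noteq> predict T e"
        let ?M = "if ?hit then M(input_end + idx x := CNat 1) else M"
        let ?Mk = "if ?hit then insert x Mk else Mk"
        have mem2: "memory_ok A ?Mk ?M" using mem memory_ok_mark[OF mem q(4)] by simp
        have stack2: "stack_at ?M st0 q"
          using stack0 stack_at_below[OF stack0] idx_less[OF q(4)] by (simp add: stack_bottom_def)
        have nec2: "necessary = ?Mk \<union> found st0"
          using nec by (auto simp: st Leaf flips_Leaf)
        have "R2 r_out = CNat input_end" "R2 r_one = CNat 1" "R2 r_sp = CNat q"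
          "R2 r_bottom = CNat (Suc stack_bottom)" "R2 r_class = CNat (predict T e)"
          using R1' R1(2) R2 by simp_all
        from search_invI[OF this mem2 stack2 nec2 refl]
        show "\<exists>m'<m. search_inv m' (R2, ?M)"
          by (rule exI[of _ "weight st0", OF conjI, rotated]) (simp add: m st Leaf)
      qed
      then show ?thesis using R1(8) R1'(2) leaf(1) by simp
    next
      case (Node l t u)
      have kind: "\<exists>j\<ge>1. M a = CNat j" using kind_of_Node[OF q(3)[unfolded Node] mem] .
      have "wp expand_node (\<lambda>s'. \<exists>m'<m. search_inv m' s') (R1, M)"
      proof (rule wp_expand_node[where R = R1 and M = M and a = a, OF mem stack0 q(3)[unfolded Node] q(4) rep R1(3) R1'(2) R1(8) R1'(5) R1(2)])
        fix R2 M2 st2 p2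
        assume R2: "\<forall>r\<in>{r_out, r_one, r_bottom, r_class}. R2 r = R1 r" "R2 r_sp = CNat p2"
          and mem2: "memory_ok A Mk M2" and stack2: "stack_at M2 st2 p2"
          and found2: "found st2 = found ((Node l t u, x, V) # st0)"
          and weight2: "weight st2 < weight ((Node l t u, x, V) # st0)"
        have nec2: "necessary = Mk \<union> found st2" using nec found2 by (simp add: st Node)
        have "R2 r_out = CNat input_end" "R2 r_one = CNat 1" "R2 r_sp = CNat p2"
          "R2 r_bottom = CNat (Suc stack_bottom)" "R2 r_class = CNat (predict T e)"
          using R1' R2 by simp_all
        from search_invI[OF this mem2 stack2 nec2 refl]
        show "\<exists>m'<m. search_inv m' (R2, M2)"
          by (rule exI[of _ "weight st2", OF conjI, rotated]) (use weight2 in \<open>simp add: m st Node\<close>)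
      qed
      then show ?thesis using R1(8) R1'(2) kind by auto
    qed
  qed
qed

section \<open>The initial state and the composition of the phases\<close>

lemma mem0_ok: "memory_ok (\<lambda>x. domain_values (dm x)) {} mem0"
  and subtree_root: "subtree T table_end"
proof -
  let ?I = "input_cells fs dm T e"
  have mem0: "mem0 a = (if a < length ?I then ?I ! a else CNat 0)" for a
    by (simp add: mem0_def initial_state_def Let_def)
  then have "cells_at mem0 0 ?I" by (simp add: cells_at_def)
  then have table: "cells_at mem0 0 (feature_table fs dm e)"
    and root: "cells_at mem0 table_end (tree_cells fs table_end T)"
    by (simp_all add: input_cells_def table_end_def)
  show "subtree T table_end"
    using tree_at_tree_cells[OF root order_refl, of input_end] tree
    by (simp add: subtree_def input_end_def input_cells_def table_end_def)
  have row: "represents (dm x) (mem0 (4 * idx x)) (mem0 (4 * idx x + 1)) (mem0 (4 * idx x + 2))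
      (domain_values (dm x)) \<and> mem0 (4 * idx x + 3) = value_cell (e x)" if x: "x \<in> X" for x
  proof -
    have "fs ! idx x = x" using position_in_set(2) distinct set_fs x by metis
    with feature_table_at[OF table idx_less[OF x]]
    have cells: "cells_at mem0 (4 * idx x) (domain_cells (dm x))" "mem0 (4 * idx x + 3) = value_cell (e x)"
      by simp_all
    have "domain_cells (dm x) ! j = mem0 (4 * idx x + j)" if "j < 3" for j
      using cells(1) that by (simp add: cells_at_def)
    from this[of 0] this[of 1] this[of 2] have
      "domain_cells (dm x) ! 0 = mem0 (4 * idx x)" "domain_cells (dm x) ! 1 = mem0 (4 * idx x + 1)"
      "domain_cells (dm x) ! 2 = mem0 (4 * idx x + 2)" by simp_all
    moreover have "admissible_domain (dm x)" "e x \<in> domain_values (dm x)"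
      using space entity x by (auto simp: feature_space_def entities_def)
    ultimately show ?thesis using represents_domain_cells[of "dm x" "e x"] cells(2) by simp
  qed
  \<comment> \<open>The output zone lies beyond the input, where memory cells are 0, so initially no
    feature is flagged.\<close>
  then show "memory_ok (\<lambda>x. domain_values (dm x)) {} mem0"
    by (simp add: memory_ok_def mem0 input_end_def)
qed

lemma run_necessary_program:
  "\<exists>t s. run necessary_program (initial_state fs dm T e) t s \<and>
     t \<le> (cost prepare + cost read_class + cost walk_body + cost search_body + 4) * num_nodes T \<and>
     outputs_set fs input_end s necessary"
proof -
  let ?n = "num_nodes T"
  obtain R0 where s0: "initial_state fs dm T e = (R0, mem0)"
    and R0: "R0 0 = CNat (length fs)" "R0 r_node = CNat table_end" "R0 r_out = CNat input_end"
    by (simp add: mem0_def initial_state_def Let_def table_end_def input_end_def)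
  have nec: "necessary = {x \<in> X. flips T x (domain_values (dm x))}"
    using necessary_features_eq[of X e dm "predict T"] space entity
    by (simp add: feature_space_def flips_def)
  let ?R1 = "R0(r_one := CNat 1, r_sp := CNat stack_bottom, r_bottom := CNat (Suc stack_bottom),
    r_kind := mem0 table_end)"
  have "walk_inv ?n (?R1, mem0)"
    using R0 mem0_ok subtree_root nec
    by (intro walk_invI[where w = T and A = "\<lambda>x. domain_values (dm x)" and st = "[]"
          and a = table_end and p = stack_bottom]) simp_all
  then have "wp prepare (walk_inv ?n) (R0, mem0)"
    using R0 by (simp add: prepare_def stack_bottom_def)
  from wp_run[OF this] obtain t1 s1 where 1: "run prepare (R0, mem0) t1 s1" "t1 \<le> cost prepare"
    "walk_inv ?n s1" by blast
  have test1: "eval_test (TNatLe r_one r_kind) s \<noteq> None" if "walk_inv m s" for m s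
  proof -
    from that obtain R M w a A where s: "s = (R, M)"
      and I: "R r_kind = M a" "R r_one = CNat 1" "subtree w a" "memory_ok A {} M"
      by (rule walk_invE)
    have "\<exists>j. M a = CNat j"
    proof (cases w)
      case (Leaf c)
      then show ?thesis using subtree_in_memory[OF I(3,4)] by simp
    next
      case (Node l t u)
      then show ?thesis using kind_of_Node[OF _ I(4)] I(3) by blast
    qed
    with I s show ?thesis by auto
  qed
  have "\<exists>t s' m'. run (Loop (TNatLe r_one r_kind) walk_body) s1 t s' \<and>
      t \<le> 1 + (1 + cost walk_body) * ?n \<and> m' \<le> ?n \<and> walk_inv m' s' \<and>
      eval_test (TNatLe r_one r_kind) s' = Some False"
    by (rule loop_run[where I = walk_inv], erule test1, erule (1) walk_step, rule 1(3))
  then obtain t2 s2 m2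
    where 2: "run (Loop (TNatLe r_one r_kind) walk_body) s1 t2 s2" "t2 \<le> 1 + (1 + cost walk_body) * ?n"
      "m2 \<le> ?n" "walk_inv m2 s2" "eval_test (TNatLe r_one r_kind) s2 = Some False"
    by blast
  from 2(4) obtain R2 M2 w A st a p where s2: "s2 = (R2, M2)"
    and I: "R2 r_node = CNat a" "R2 r_out = CNat input_end"
      "R2 r_kind = M2 a" "R2 r_one = CNat 1" "R2 r_sp = CNat p" "R2 r_bottom = CNat (Suc stack_bottom)"
      "subtree w a" "memory_ok A {} M2" "stack_at M2 st p" "predict w e = predict T e"
      "necessary = {x \<in> X. flips w x (A x)} \<union> found st" "m2 = num_nodes w + weight st"
    by (rule walk_invE)
  obtain c where w: "w = Leaf c"
  proof (cases w)
    case (Node l t u)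
    with kind_of_Node[OF _ I(8)] I(7) have "\<exists>j\<ge>1. M2 a = CNat j" by blast
    with 2(5) s2 I show ?thesis by auto
  qed
  have leaf_class: "M2 (a + 1) = CNat (predict T e)" using subtree_in_memory[OF I(7,8)] I(10) w by simp
  \<comment> \<open>The walk ends at a leaf with the class of \<open>e\<close> itself, where nothing
    flips, so every necessary feature is found in a stacked branch.\<close>
  have "necessary = {} \<union> found st" using I(10,11) w by (simp add: flips_Leaf)
  then have "search_inv (weight st) (R2(r_tmp := CNat (a + 1), r_class := CNat (predict T e)), M2)"
    using I by (intro search_invI[where A = A and Mk = "{}" and st = st and p = p]) simp_all
  then have "wp read_class (search_inv (weight st)) (R2, M2)"
    using I(1,4) leaf_class by (simp add: read_class_def)
  from wp_run[OF this] obtain t3 s3 where 3: "run read_class s2 t3 s3" "t3 \<le> cost read_class"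
    "search_inv (weight st) s3" unfolding s2 by blast
  have test2: "eval_test (TNatLe r_bottom r_sp) s \<noteq> None" if "search_inv m s" for m s
    using that by (rule search_invE) simp
  have "\<exists>t s' m'. run (Loop (TNatLe r_bottom r_sp) search_body) s3 t s' \<and>
      t \<le> 1 + (1 + cost search_body) * weight st \<and> m' \<le> weight st \<and> search_inv m' s' \<and>
      eval_test (TNatLe r_bottom r_sp) s' = Some False"
    by (rule loop_run[where I = search_inv], erule test2, erule (1) search_step, rule 3(3))
  then obtain t4 s4 m4
    where 4: "run (Loop (TNatLe r_bottom r_sp) search_body) s3 t4 s4"
      "t4 \<le> 1 + (1 + cost search_body) * weight st"
      "search_inv m4 s4" "eval_test (TNatLe r_bottom r_sp) s4 = Some False"
    by blast
  from 4(3) obtain R4 M4 A4 Mk st4 p4 where s4: "s4 = (R4, M4)"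
    and J: "R4 r_sp = CNat p4" "R4 r_bottom = CNat (Suc stack_bottom)" "memory_ok A4 Mk M4"
      "stack_at M4 st4 p4" "necessary = Mk \<union> found st4"
    by (rule search_invE)
  have "st4 = []"
  proof (cases st4)
    case (Cons it st')
    obtain w' x' V' where "it = (w', x', V')" by (cases it) auto
    with J(4) Cons obtain q where "p4 = q + 5" "stack_at M4 st' q" by auto
    with stack_at_ge[of M4 st' q] 4(4) s4 J show ?thesis by auto
  qed
  with J have marked: "memory_ok A4 necessary M4" by simp
  have "outputs_set fs input_end s4 necessary"
    unfolding outputs_set_def
  proof (intro allI impI)
    fix i assume i: "i < length fs"
    then have "fs ! i \<in> X" using set_fs by auto
    with marked position_nth[OF distinct i]
    show "snd s4 (input_end + i) = CNat (if fs ! i \<in> necessary then 1 else 0)"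
      unfolding memory_ok_def s4 by fastforce
  qed
  moreover have "run necessary_program (initial_state fs dm T e) (t1 + (t2 + (t3 + t4))) s4"
    unfolding s0 necessary_program_def using 1(1) 2(1) 3(1) 4(1) by (blast intro: run_Seq)
  \<comment> \<open>The summand 4 pays for the tests: each loop has one per round and a last one,
    and the last ones are absorbed because a tree has at least one node.\<close>
  moreover have "t1 + (t2 + (t3 + t4)) \<le>
    (cost prepare + cost read_class + cost walk_body + cost search_body + 4) * ?n"
  proof -
    have n: "1 \<le> ?n" by (cases T) auto
    \<comment> \<open>The measure left over by the walk still bounds the stacked subtrees, so the
      search is charged to the same nodes.\<close>
    have "weight st \<le> ?n" using I(12) 2(3) by simp
    then have "(1 + cost search_body) * weight st \<le> (1 + cost search_body) * ?n" by (rule mult_le_mono2)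
    moreover have "cost prepare \<le> cost prepare * ?n" "cost read_class \<le> cost read_class * ?n"
      using n by simp_all
    ultimately show ?thesis using 1(2) 2(2) 3(2) 4(2) n
      unfolding add_mult_distrib mult_1 by linarith
  qed
  ultimately show ?thesis by blast
qed

end

theorem proposition20:
  "\<exists>(P :: program) (C :: nat).
     \<forall>(X :: 'f set) (dm :: 'f \<Rightarrow> 'c fdomain) (k :: nat) (T :: ('f, 'c) dtree)
       (e :: 'f \<Rightarrow> 'c fvalue) (fs :: 'f list).
       feature_space X dm \<longrightarrow> decision_tree k X dm T \<longrightarrow> e \<in> entities X dm \<longrightarrow>
       distinct fs \<longrightarrow> set fs = X \<longrightarrow>
       (\<exists>t s. run P (initial_state fs dm T e) t s \<and>
          t \<le> C * (card X + num_nodes T) \<and>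
          outputs_set fs (length (input_cells fs dm T e)) s
            (necessary_features X dm (predict T) e))"
proof -
  define C where "C = cost prepare + cost read_class + cost walk_body + cost search_body + 4"
  show ?thesis
  proof (rule exI[of _ necessary_program], rule exI[of _ C], intro allI impI)
    fix X :: "'f set" and dm :: "'f \<Rightarrow> 'c fdomain" and k T e and fs :: "'f list"
    assume "feature_space X dm" "decision_tree k X dm T" "e \<in> entities X dm" "distinct fs" "set fs = X"
    then interpret tree_input X dm k T e fs by unfold_locales
    from run_necessary_program obtain t s where
      "run necessary_program (initial_state fs dm T e) t s" "t \<le> C * num_nodes T"
      "outputs_set fs (length (input_cells fs dm T e)) s (necessary_features X dm (predict T) e)"
      unfolding C_def input_end_def by blast
    moreover have "C * num_nodes T \<le> C * (card X + num_nodes T)" by simp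
    ultimately show "\<exists>t s. run necessary_program (initial_state fs dm T e) t s \<and>
        t \<le> C * (card X + num_nodes T) \<and>
        outputs_set fs (length (input_cells fs dm T e)) s (necessary_features X dm (predict T) e)"
      using le_trans by blast
  qed
qed

end
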